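(* Let $X$ be a complete noncompact length space with a universal cover. If the covering spectrum $CovSpec(X)$ has a positive infimum (i.e. it is nonempty and $\inf CovSpec(X)>0$), then the universal delta cover $\tilde X^0$ is a $\delta$ cover (i.e. $\tilde X^0=\tilde X^\delta$ for some $\delta>0$) and $\inf CovSpec(X)\in CovSpec(X)$.
   Context: A complete length space is a complete metric space in which every pair of points is joined by a length-minimizing rectifiable curve whose length is the distance between the points. A universal cover $\tilde X$ of $X$ is a covering space of $X$ that covers every other covering space of $X$ (it is not assumed simply connected); covering spaces carry the lifted length metric. Each $g\in\pi_1(X)$ is viewed as a deck transformation of $\tilde X$, with length $L(g)=\inf_{\tilde x\in\tilde X}d_{\tilde X}(g\tilde x,\tilde x)$. For $\delta>0$, $\pi_1(X,\delta)$ is the subgroup of $\pi_1(X)$ generated by all $g$ with $L(g)<2\delta$, and the $\delta$ cover is $\tilde X^\delta=\tilde X/\pi_1(X,\delta)$. The covering spectrum $CovSpec(X)$ is the set of all $\delta>0$ such that $\tilde X^\delta\neq\tilde X^{\delta'}$ for all $\delta'>\delta$; equivalently, $\pi_1(X,\delta)\neq\pi_1(X,\delta')$ for all $\delta'>\delta$. The universal delta cover $\tilde X^0$ is a covering space of $X$ which covers all the $\delta$ covers $\tilde X^\delta$, $\delta>0$, and such that any other covering space of $X$ which covers all the $\delta$ covers also covers $\tilde X^0$. *)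

theory Defs
  imports "HOL-Analysis.Analysis" "HOL-Algebra.Generated_Groups" "HOL-Algebra.Group_Action"
begin

section \<open>Length spaces\<close>

definition curve_length :: "'a metric \<Rightarrow> (real \<Rightarrow> 'a) \<Rightarrow> ennreal" where
  "curve_length m \<gamma> =
     (SUP ts \<in> {ts. sorted ts \<and> set ts \<subseteq> {0..1}}.
        ennreal (\<Sum>i<length ts - 1. mdist m (\<gamma> (ts ! i)) (\<gamma> (ts ! Suc i))))"

definition complete_length_space :: "'a metric \<Rightarrow> bool" where
  "complete_length_space m \<longleftrightarrow>
     mcomplete_of m \<and>
     (\<forall>x\<in>mspace m. \<forall>y\<in>mspace m.
        \<exists>\<gamma>. pathin (mtopology_of m) \<gamma> \<and> \<gamma> 0 = x \<and> \<gamma> 1 = y \<and>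
            curve_length m \<gamma> = ennreal (mdist m x y))"


section \<open>Covering spaces\<close>

text \<open>The analogue for abstract topologies of the library's \<^const>\<open>covering_space\<close>, which is
  restricted to subspaces of types of class \<^class>\<open>topological_space\<close>.\<close>

definition covering_map :: "'b topology \<Rightarrow> 'a topology \<Rightarrow> ('b \<Rightarrow> 'a) \<Rightarrow> bool" where
  "covering_map E X p \<longleftrightarrow>
     continuous_map E X p \<and> p ` topspace E = topspace X \<and>
     (\<forall>x\<in>topspace X. \<exists>U. x \<in> U \<and> openin X U \<and>
        (\<exists>\<V>. \<Union>\<V> = {e \<in> topspace E. p e \<in> U} \<and>
              (\<forall>V\<in>\<V>. openin E V) \<and>
              pairwise disjnt \<V> \<and>
              (\<forall>V\<in>\<V>. homeomorphic_map (subtopology E V) (subtopology X U) p)))"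

text \<open>A covering space is a total space together with its projection.\<close>

type_synonym ('b, 'a) cover = "'b topology \<times> ('b \<Rightarrow> 'a)"

abbreviation total :: "('b, 'a) cover \<Rightarrow> 'b topology" where
  "total \<equiv> fst"

abbreviation proj :: "('b, 'a) cover \<Rightarrow> 'b \<Rightarrow> 'a" where
  "proj \<equiv> snd"

text \<open>Covering spaces are connected; otherwise no covering space could cover all the others.\<close>

definition is_cover :: "'a metric \<Rightarrow> ('b, 'a) cover \<Rightarrow> bool" where
  "is_cover m C \<longleftrightarrow>
     connected_space (total C) \<and> covering_map (total C) (mtopology_of m) (proj C)"

definition covers :: "('b, 'a) cover \<Rightarrow> ('c, 'a) cover \<Rightarrow> bool" where
  "covers C D \<longleftrightarrow>
     (\<exists>f. covering_map (total C) (total D) f \<and> (\<forall>x\<in>topspace (total C). proj D (f x) = proj C x))"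

text \<open>Equality of covering spaces: homeomorphism over the base.\<close>

definition same_cover :: "('b, 'a) cover \<Rightarrow> ('c, 'a) cover \<Rightarrow> bool" where
  "same_cover C D \<longleftrightarrow>
     (\<exists>f. homeomorphic_map (total C) (total D) f \<and>
          (\<forall>x\<in>topspace (total C). proj D (f x) = proj C x))"

text \<open>``Every covering space'' cannot range over all types inside a formula, so we fix one point type
  that realises every connected covering space \<open>q : Y \<rightarrow> X\<close> of a length space \<open>X\<close> up to homeomorphism
  over \<open>X\<close>: given \<open>y\<^sub>0 \<in> Y\<close>, represent \<open>y\<close> by the set of all \<open>q \<circ> \<gamma>\<close> with \<open>\<gamma>\<close> a path in \<open>Y\<close> from \<open>y\<^sub>0\<close>
  to \<open>y\<close>. These sets are nonempty because \<open>Y\<close> is path connected, and disjoint for distinct \<open>y\<close>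
  by uniqueness of path lifting.\<close>

type_synonym 'a cover_point = "(real \<Rightarrow> 'a) set"

definition universal_cover :: "'a metric \<Rightarrow> ('b, 'a) cover \<Rightarrow> bool" where
  "universal_cover m C \<longleftrightarrow>
     is_cover m C \<and> (\<forall>D :: ('a cover_point, 'a) cover. is_cover m D \<longrightarrow> covers C D)"


section \<open>Lifted length metric, deck transformations, \<open>\<delta>\<close> covers\<close>

text \<open>The length of a curve upstairs is the length of its projection.\<close>

definition lifted_dist :: "'a metric \<Rightarrow> ('b, 'a) cover \<Rightarrow> 'b \<Rightarrow> 'b \<Rightarrow> ennreal" where
  "lifted_dist m C x y =
     (INF \<gamma> \<in> {\<gamma>. pathin (total C) \<gamma> \<and> \<gamma> 0 = x \<and> \<gamma> 1 = y}. curve_length m (proj C \<circ> \<gamma>))"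

definition deck :: "('b, 'a) cover \<Rightarrow> ('b \<Rightarrow> 'b) set" where
  "deck C = {g \<in> Bij (topspace (total C)).
               homeomorphic_map (total C) (total C) g \<and>
               (\<forall>x\<in>topspace (total C). proj C (g x) = proj C x)}"

text \<open>For a universal cover \<open>C\<close> this plays the role of \<open>\<pi>\<^sub>1(X)\<close>. As \<open>C\<close> need not be simply connected,
  loops acting trivially on \<open>C\<close> are identified with the neutral element; they have length \<open>0\<close>, hence
  lie in every \<open>\<pi>\<^sub>1(X, \<delta>)\<close>, so nothing below is affected.\<close>

definition deck_group :: "('b, 'a) cover \<Rightarrow> ('b \<Rightarrow> 'b) monoid" where
  "deck_group C = BijGroup (topspace (total C)) \<lparr>carrier := deck C\<rparr>"

lemma group_deck_group: "group (deck_group C)"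
proof -
  let ?S = "topspace (total C)"
  have "subgroup (deck C) (BijGroup ?S)"
  proof (rule group.subgroupI[OF group_BijGroup])
    show "deck C \<subseteq> carrier (BijGroup ?S)"
      by (auto simp: deck_def BijGroup_def)
    have "homeomorphic_map (total C) (total C) (\<lambda>x\<in>?S. x)"
      by (rule homeomorphic_map_eq[OF homeomorphic_map_id[THEN iffD2]]) auto
    then show "deck C \<noteq> {}"
      using id_Bij by (fastforce simp: deck_def)
  next
    fix g assume g: "g \<in> deck C"
    then have bij: "g \<in> Bij ?S" and bb: "bij_betw g ?S ?S"
      by (auto simp: deck_def Bij_def)
    obtain h where h: "homeomorphic_maps (total C) (total C) g h"
      using g by (auto simp: deck_def homeomorphic_map_maps)
    have hS: "h x \<in> ?S" "g (h x) = x" if "x \<in> ?S" for x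
      using h that by (auto simp: homeomorphic_maps_def continuous_map_def)
    have eq: "inv_into ?S g x = h x" if "x \<in> ?S" for x
      using hS[OF that] bb by (metis bij_betw_imp_inj_on inv_into_f_f)
    have "homeomorphic_map (total C) (total C) h"
      using h homeomorphic_maps_map by blast
    then have "homeomorphic_map (total C) (total C) (\<lambda>x\<in>?S. inv_into ?S g x)"
      by (rule homeomorphic_map_eq) (simp add: eq)
    moreover have "proj C (inv_into ?S g x) = proj C x" if "x \<in> ?S" for x
      using g hS[OF that] eq[OF that] by (force simp: deck_def)
    ultimately show "inv\<^bsub>BijGroup ?S\<^esub> g \<in> deck C"
      using restrict_inv_into_Bij[OF bij] by (simp add: inv_BijGroup[OF bij] deck_def)
  next
    fix g h assume gh: "g \<in> deck C" "h \<in> deck C"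
    then have bij: "g \<in> Bij ?S" "h \<in> Bij ?S"
      by (auto simp: deck_def)
    have "homeomorphic_map (total C) (total C) (g \<circ> h)"
      using gh by (auto simp: deck_def intro: homeomorphic_map_compose)
    then have "homeomorphic_map (total C) (total C) (compose ?S g h)"
      by (rule homeomorphic_map_eq) (simp add: compose_def)
    moreover have "h x \<in> ?S" if "x \<in> ?S" for x
      using Bij_imp_funcset[OF bij(2)] that by auto
    ultimately show "g \<otimes>\<^bsub>BijGroup ?S\<^esub> h \<in> deck C"
      using gh bij compose_Bij[OF bij] by (simp add: BijGroup_def deck_def compose_def)
  qed
  then show ?thesis
    unfolding deck_group_def by (rule group.subgroup_imp_group[OF group_BijGroup])
qed

definition deck_length :: "'a metric \<Rightarrow> ('b, 'a) cover \<Rightarrow> ('b \<Rightarrow> 'b) \<Rightarrow> ennreal" where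
  "deck_length m C g = (INF x \<in> topspace (total C). lifted_dist m C (g x) x)"

definition pi1_delta :: "'a metric \<Rightarrow> ('b, 'a) cover \<Rightarrow> real \<Rightarrow> ('b \<Rightarrow> 'b) set" where
  "pi1_delta m C \<delta> =
     generate (deck_group C) {g \<in> deck C. deck_length m C g < ennreal (2 * \<delta>)}"

definition quotient_topology :: "'b topology \<Rightarrow> ('b \<Rightarrow> 'c) \<Rightarrow> 'c topology" where
  "quotient_topology E q =
     topology (\<lambda>U. U \<subseteq> q ` topspace E \<and> openin E {x \<in> topspace E. q x \<in> U})"

lemma openin_quotient_topology:
  "openin (quotient_topology E q) U \<longleftrightarrow>
     U \<subseteq> q ` topspace E \<and> openin E {x \<in> topspace E. q x \<in> U}"
proof -
  have "istopology (\<lambda>U. U \<subseteq> q ` topspace E \<and> openin E {x \<in> topspace E. q x \<in> U})"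
    unfolding istopology_def
  proof (intro conjI allI impI)
    fix S T
    assume "S \<subseteq> q ` topspace E \<and> openin E {x \<in> topspace E. q x \<in> S}"
      and "T \<subseteq> q ` topspace E \<and> openin E {x \<in> topspace E. q x \<in> T}"
    moreover have "{x \<in> topspace E. q x \<in> S \<inter> T} =
        {x \<in> topspace E. q x \<in> S} \<inter> {x \<in> topspace E. q x \<in> T}"
      by auto
    ultimately show "S \<inter> T \<subseteq> q ` topspace E" "openin E {x \<in> topspace E. q x \<in> S \<inter> T}"
      by (auto simp only: openin_Int)
  next
    fix \<K>
    assume *: "\<forall>K\<in>\<K>. K \<subseteq> q ` topspace E \<and> openin E {x \<in> topspace E. q x \<in> K}"
    have "{x \<in> topspace E. q x \<in> \<Union>\<K>} = (\<Union>K\<in>\<K>. {x \<in> topspace E. q x \<in> K})"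
      by auto
    with * show "\<Union>\<K> \<subseteq> q ` topspace E" "openin E {x \<in> topspace E. q x \<in> \<Union>\<K>}"
      by auto
  qed
  then show ?thesis
    by (simp add: quotient_topology_def topology_inverse')
qed

lemma topspace_quotient_topology [simp]:
  "topspace (quotient_topology E q) = q ` topspace E"
proof
  show "topspace (quotient_topology E q) \<subseteq> q ` topspace E"
    by (metis openin_quotient_topology openin_topspace)
  have "{x \<in> topspace E. q x \<in> q ` topspace E} = topspace E"
    by auto
  then have "openin (quotient_topology E q) (q ` topspace E)"
    by (simp add: openin_quotient_topology)
  then show "q ` topspace E \<subseteq> topspace (quotient_topology E q)"
    by (rule openin_subset)
qed

lemma quotient_map_quotient_topology: "quotient_map E (quotient_topology E q) q"
  by (simp add: quotient_map_def openin_quotient_topology)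

text \<open>For a subgroup \<open>H\<close> of the deck group: the points of \<open>C/H\<close> are the \<open>H\<close>-orbits, and the
  projection sends an orbit to the common image of its elements.\<close>

definition quotient_cover :: "('b, 'a) cover \<Rightarrow> ('b \<Rightarrow> 'b) set \<Rightarrow> ('b set, 'a) cover" where
  "quotient_cover C H =
     (quotient_topology (total C) (orbit (deck_group C \<lparr>carrier := H\<rparr>) (\<lambda>g. g)),
      \<lambda>A. the_elem (proj C ` A))"

definition delta_cover :: "'a metric \<Rightarrow> ('b, 'a) cover \<Rightarrow> real \<Rightarrow> ('b set, 'a) cover" where
  "delta_cover m C \<delta> = quotient_cover C (pi1_delta m C \<delta>)"

definition CovSpec :: "'a metric \<Rightarrow> ('b, 'a) cover \<Rightarrow> real set" where
  "CovSpec m C =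
     {\<delta>. \<delta> > 0 \<and> (\<forall>\<delta>'>\<delta>. \<not> same_cover (delta_cover m C \<delta>) (delta_cover m C \<delta>'))}"

definition universal_delta_cover ::
    "'a metric \<Rightarrow> ('b, 'a) cover \<Rightarrow> ('c, 'a) cover \<Rightarrow> bool" where
  "universal_delta_cover m C Y \<longleftrightarrow>
     is_cover m Y \<and> (\<forall>\<delta>>0. covers Y (delta_cover m C \<delta>)) \<and>
     (\<forall>Z :: ('a cover_point, 'a) cover.
        is_cover m Z \<and> (\<forall>\<delta>>0. covers Z (delta_cover m C \<delta>)) \<longrightarrow> covers Z Y)"

end

theory Submission
  imports Defs
begin

text \<open>
  Write \<open>G\<close> for the deck group of the universal cover \<open>C\<close>, \<open>\<pi>(\<delta>)\<close> for the subgroup generated by the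
  deck transformations of length less than \<open>2\<delta>\<close>, and \<open>s\<close> for the infimum of the covering spectrum.

  The argument about the spectrum is short once the spectrum is read off the groups, that is, once
  \<open>C/\<pi>(\<delta>)\<close> and \<open>C/\<pi>(\<epsilon>)\<close> are known to be equal as covers only if \<open>\<pi>(\<delta>) = \<pi>(\<epsilon>)\<close>. The groups \<open>\<pi>(\<delta>)\<close>
  increase with \<open>\<delta>\<close>, and they are continuous from the left, because they are generated by a strict
  inequality (\<open>pi1_delta_subset_if_approached\<close>). If \<open>s\<close> were not in the spectrum, \<open>\<pi>\<close> would be constant on
  an interval to the right of \<open>s\<close>, which contains elements of the spectrum: contradiction
  (\<open>Inf_CovSpec_in_CovSpec\<close>). Below \<open>s\<close> there is no spectrum, so \<open>\<pi>\<close> cannot jump to the right of any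
  point, and by left continuity it cannot jump at any point either; hence \<open>\<pi>(\<delta>) = \<pi>(s)\<close> for
  \<open>0 < \<delta> \<le> s\<close> (\<open>pi1_delta_constant_below_Inf_CovSpec\<close>). So \<open>C/\<pi>(s)\<close> is one of the \<open>\<delta>\<close> covers and covers all
  of them, which is the universal property. Any other \<open>Y\<close> with this property fits into morphisms
  \<open>C/\<pi>(s) \<rightarrow> Y \<rightarrow> C/\<pi>(s)\<close>. An endomorphism of \<open>C/\<pi>(s)\<close> is injective
  (\<open>quotient_cover_endomorphism_inj\<close>) and the first map is surjective, so the second one is a
  homeomorphism.

  The two statements about quotients used here, \<open>same_quotient_cover_imp_eq\<close> and
  \<open>quotient_cover_endomorphism_inj\<close>, rest on the fact that a morphism \<open>C/H \<rightarrow> C/K\<close> is induced by a deck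
  transformation of \<open>C\<close>, together with normality of \<open>\<pi>(\<delta>)\<close>, which holds because length is invariant
  under conjugation. Such morphisms are induced by deck transformations as soon as \<open>G\<close> acts
  transitively on a fibre of \<open>C\<close>, and this is the main point: the universal cover is only known to cover
  every other cover, and it need not be simply connected. In terms of subgroups of the fundamental
  group, one has to show that the subgroup of \<open>C\<close> is equal to all its conjugates. The proof
  (\<open>universal_cover_regular\<close>) constructs the regular cover \<open>D\<close> that belongs to the
  intersection of all these conjugates, as a component of the bundle whose fibre over \<open>x\<close>
  consists of the bijections from a fixed fibre of \<open>C\<close> to the fibre over \<open>x\<close>.
  Universality gives a morphism \<open>C \<rightarrow> D\<close>, and since \<open>D\<close> maps back to
  \<open>C\<close> through any prescribed point, \<open>C\<close> and \<open>D\<close> are isomorphic.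

  Length spaces are locally path connected, which lets slices be described as path components; all
  covering-space arguments use this description.
\<close>

section \<open>Sheets of a covering map\<close>

definition evenly_covered :: "'b topology \<Rightarrow> ('b \<Rightarrow> 'a) \<Rightarrow> 'a set \<Rightarrow> bool" where
  "evenly_covered E p U \<longleftrightarrow>
     (\<exists>\<V>. \<Union>\<V> = {e \<in> topspace E. p e \<in> U} \<and> (\<forall>V\<in>\<V>. openin E V \<and> bij_betw p V U) \<and>
          pairwise disjnt \<V>)"

text \<open>A covering map except that it need not be surjective. This is the form in which the bundle of
  frames below is a covering of \<open>X\<close> before a component is singled out, and for which unique lifting
  and the results on morphisms already hold.\<close>

definition partial_covering :: "'b topology \<Rightarrow> 'a topology \<Rightarrow> ('b \<Rightarrow> 'a) \<Rightarrow> bool" where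
  "partial_covering E X p \<longleftrightarrow>
     continuous_map E X p \<and> open_map E X p \<and>
     (\<forall>x\<in>topspace X. \<exists>U. x \<in> U \<and> openin X U \<and> evenly_covered E p U)"

lemma partial_coveringD:
  assumes "partial_covering E X p"
  shows "continuous_map E X p" "open_map E X p" "\<And>e. e \<in> topspace E \<Longrightarrow> p e \<in> topspace X"
    "\<And>x. x \<in> topspace X \<Longrightarrow> \<exists>U. x \<in> U \<and> openin X U \<and> evenly_covered E p U"
  using assms unfolding partial_covering_def by (blast, blast, auto simp: continuous_map_def)

lemma homeomorphic_map_onto_open:
  assumes "continuous_map E X p" "open_map E X p" "openin E V" "bij_betw p V U"
  shows "homeomorphic_map (subtopology E V) (subtopology X U) p"
proof (rule bijective_open_imp_homeomorphic_map)
  have VE: "V \<subseteq> topspace E" and UX: "U \<subseteq> topspace X"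
    using openin_subset[OF assms(3)] assms(1,4)
    by (auto simp: bij_betw_def continuous_map_def)
  show "continuous_map (subtopology E V) (subtopology X U) p"
    using assms(1,4) by (auto simp: continuous_map_in_subtopology bij_betw_def
        intro: continuous_map_from_subtopology)
  have "openin X (p ` S) \<and> p ` S \<subseteq> U" if "openin E S" "S \<subseteq> V" for S
    using assms(2,4) that by (auto simp: open_map_def bij_betw_def)
  then show "open_map (subtopology E V) (subtopology X U) p"
    unfolding open_map_def
    using assms(3) by (metis (no_types) inf.absorb2 openin_open_subtopology openin_subtopology_Int2 openin_subtopology_Int)
  show "p ` topspace (subtopology E V) = topspace (subtopology X U)"
    "inj_on p (topspace (subtopology E V))"
    using assms(4) VE UX by (auto simp: bij_betw_def inf.absorb2)
qed

text \<open>The slices of a covering map are mapped homeomorphically, so the map is open; conversely an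
  open continuous bijection on a slice is a homeomorphism. Bijectivity is easier to check than
  homeomorphy, so coverings are handled in this form from here on.\<close>

lemma covering_map_iff:
  "covering_map E X p \<longleftrightarrow> partial_covering E X p \<and> p ` topspace E = topspace X"
proof
  assume L: "covering_map E X p"
  have cont: "continuous_map E X p"
    using L by (simp add: covering_map_def)
  have ex: "\<exists>U. x \<in> U \<and> openin X U \<and> (\<exists>\<V>. \<Union>\<V> = {e \<in> topspace E. p e \<in> U} \<and>
              (\<forall>V\<in>\<V>. openin E V) \<and> pairwise disjnt \<V> \<and>
              (\<forall>V\<in>\<V>. homeomorphic_map (subtopology E V) (subtopology X U) p))"
    if "x \<in> topspace X" for x
    using L that by (simp add: covering_map_def)
  have "open_map E X p"
    unfolding open_map_def
  proof (intro allI impI)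
    fix S assume S: "openin E S"
    have "\<exists>T. openin X T \<and> x \<in> T \<and> T \<subseteq> p ` S" if "x \<in> p ` S" for x
    proof -
      obtain e where e: "e \<in> S" "x = p e" using \<open>x \<in> p ` S\<close> by auto
      then have eE: "e \<in> topspace E" using S openin_subset by blast
      then obtain U \<V> where U: "x \<in> U" "openin X U" and V: "\<Union>\<V> = {e \<in> topspace E. p e \<in> U}"
          "\<forall>V\<in>\<V>. homeomorphic_map (subtopology E V) (subtopology X U) p"
        using ex[of x] cont e(2) by (auto simp: continuous_map_def Pi_iff)
      then obtain V where Ve: "V \<in> \<V>" "e \<in> V" using eE e(2) by blast
      then have "open_map (subtopology E V) (subtopology X U) p"
        using V(2) homeomorphic_imp_open_map by blast
      then have "openin (subtopology X U) (p ` (V \<inter> S))"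
        using S by (simp add: open_map_def openin_subtopology_Int2)
      then have "openin X (p ` (V \<inter> S))"
        using U(2) openin_trans_full by blast
      then show ?thesis using e Ve by blast
    qed
    then show "openin X (p ` S)" using openin_subopen by blast
  qed
  moreover have "\<exists>U. x \<in> U \<and> openin X U \<and> evenly_covered E p U" if x: "x \<in> topspace X" for x
  proof -
    obtain U \<V> where U: "x \<in> U" "openin X U" and V: "\<Union>\<V> = {e \<in> topspace E. p e \<in> U}"
        "\<forall>V\<in>\<V>. openin E V" "pairwise disjnt \<V>"
        "\<forall>V\<in>\<V>. homeomorphic_map (subtopology E V) (subtopology X U) p"
      using ex[OF x] by (elim exE conjE) (rule that, assumption+)
    have "bij_betw p V U" if "V \<in> \<V>" for V
    proof -
      have "topspace (subtopology E V) = V" "topspace (subtopology X U) = U"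
        using V(2) that U openin_subset by fastforce+
      then show ?thesis
        using V(4) that unfolding bij_betw_def
        by (metis homeomorphic_imp_injective_map homeomorphic_imp_surjective_map)
    qed
    then have "evenly_covered E p U"
      unfolding evenly_covered_def using V by (intro exI[of _ \<V>]) simp
    then show ?thesis using U by blast
  qed
  ultimately show "partial_covering E X p \<and> p ` topspace E = topspace X"
    using L by (simp add: covering_map_def partial_covering_def)
next
  assume R: "partial_covering E X p \<and> p ` topspace E = topspace X"
  show "covering_map E X p"
    unfolding covering_map_def
  proof (intro conjI ballI)
    fix x assume "x \<in> topspace X"
    then obtain U where U: "x \<in> U" "openin X U" "evenly_covered E p U"
      using R by (auto simp: partial_covering_def)
    then obtain \<V> where V: "\<Union>\<V> = {e \<in> topspace E. p e \<in> U}"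
        "\<forall>V\<in>\<V>. openin E V \<and> bij_betw p V U" "pairwise disjnt \<V>"
      unfolding evenly_covered_def by (elim exE conjE) (rule that, assumption+)
    moreover have "\<forall>V\<in>\<V>. homeomorphic_map (subtopology E V) (subtopology X U) p"
      using R V(2) by (auto simp: partial_covering_def intro: homeomorphic_map_onto_open)
    ultimately show "\<exists>U. x \<in> U \<and> openin X U \<and> (\<exists>\<V>. \<Union>\<V> = {e \<in> topspace E. p e \<in> U} \<and>
              (\<forall>V\<in>\<V>. openin E V) \<and> pairwise disjnt \<V> \<and>
              (\<forall>V\<in>\<V>. homeomorphic_map (subtopology E V) (subtopology X U) p))"
      using U(1,2) by (intro exI[of _ U] conjI exI[of _ \<V>]) auto
  qed (use R in \<open>auto simp: partial_covering_def\<close>)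
qed

text \<open>The slices over \<open>U\<close> are not canonical in general, but over a path-connected \<open>U\<close> they are
  necessarily the path components of the preimage. Describing slices as path components makes them
  visibly compatible with shrinking \<open>U\<close>, with morphisms of coverings, and with deck transformations.\<close>

definition sheet :: "'b topology \<Rightarrow> ('b \<Rightarrow> 'a) \<Rightarrow> 'a set \<Rightarrow> 'b \<Rightarrow> 'b set" where
  "sheet E p U e = path_component_of_set (subtopology E {z \<in> topspace E. p z \<in> U}) e"

definition sheeted :: "'b topology \<Rightarrow> 'a topology \<Rightarrow> ('b \<Rightarrow> 'a) \<Rightarrow> 'a set \<Rightarrow> bool" where
  "sheeted E X p U \<longleftrightarrow> openin X U \<and>
     (\<forall>e\<in>topspace E. p e \<in> U \<longrightarrow> openin E (sheet E p U e) \<and> bij_betw p (sheet E p U e) U)"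

lemma sheet_self: "e \<in> sheet E p U e \<longleftrightarrow> e \<in> topspace E \<and> p e \<in> U"
  by (auto simp: sheet_def path_component_of_refl)

lemma in_sheetD:
  assumes "z \<in> sheet E p U e"
  shows "z \<in> topspace E \<and> p z \<in> U \<and> e \<in> topspace E \<and> p e \<in> U"
  using assms path_component_in_topspace[of "subtopology E {z \<in> topspace E. p z \<in> U}" e z]
  by (simp add: sheet_def)

lemma sheet_eq: "z \<in> sheet E p U e \<Longrightarrow> sheet E p U z = sheet E p U e"
  by (simp add: sheet_def path_component_of_equiv)

lemma sheet_sym: "z \<in> sheet E p U e \<Longrightarrow> e \<in> sheet E p U z"
  by (simp add: sheet_def path_component_of_sym)

lemma sheet_mono: "W \<subseteq> U \<Longrightarrow> sheet E p W e \<subseteq> sheet E p U e"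
proof
  fix z assume "W \<subseteq> U" "z \<in> sheet E p W e"
  then show "z \<in> sheet E p U e"
    unfolding sheet_def mem_Collect_eq
    by (elim path_component_of_mono) auto
qed

lemma path_connectedin_sheet: "path_connectedin E (sheet E p U e)"
  unfolding sheet_def by (meson path_connectedin_path_component_of path_connectedin_subtopology)

lemma path_connectedin_subset_sheet:
  assumes "path_connectedin E T" "e \<in> T" "p ` T \<subseteq> U"
  shows "T \<subseteq> sheet E p U e"
proof -
  have "T \<subseteq> topspace E" using assms(1) path_connectedin_subset_topspace by blast
  then have "path_connectedin (subtopology E {z \<in> topspace E. p z \<in> U}) T"
    using assms by (auto simp: path_connectedin_subtopology)
  then show ?thesis
    unfolding sheet_def by (rule path_component_of_maximal) (rule assms)
qed

text \<open>The part over \<open>W\<close> of a slice is path connected, being homeomorphic to \<open>W\<close>, and clopen in the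
  preimage of \<open>W\<close>, since its complement there is the union of the other slices. So it is a path
  component.\<close>

lemma sheeted_of_evenly_covered:
  assumes p: "continuous_map E X p" "open_map E X p"
    and U: "evenly_covered E p U" and W: "W \<subseteq> U" "openin X W" "path_connectedin X W"
  shows "sheeted E X p W"
  unfolding sheeted_def
proof (intro conjI ballI impI W(2))
  fix e assume e: "e \<in> topspace E" "p e \<in> W"
  obtain \<V> where V: "\<Union>\<V> = {e \<in> topspace E. p e \<in> U}"
      "\<forall>V\<in>\<V>. openin E V \<and> bij_betw p V U" "pairwise disjnt \<V>"
    using U unfolding evenly_covered_def by (elim exE conjE) (rule that, assumption+)
  let ?P = "{z \<in> topspace E. p z \<in> W}"
  obtain V where Ve: "V \<in> \<V>" "e \<in> V" using V(1) e W by blast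
  define V' where "V' = V \<inter> ?P"
  have openP: "openin E ?P"
    using p(1) W(2) by (simp add: openin_continuous_map_preimage)
  have openV': "openin E V'"
    using V(2) Ve openP by (auto simp: V'_def)
  have bijV': "bij_betw p V' W"
    using V(2) Ve(1) W(1) openin_subset[of E V]
    by (fastforce simp: V'_def bij_betw_def inj_on_def image_iff)
  obtain g where g: "homeomorphic_maps (subtopology E V') (subtopology X W) p g"
    using homeomorphic_map_onto_open[OF p openV' bijV'] homeomorphic_map_maps by blast
  have tV: "topspace (subtopology E V') = V'" and tW: "topspace (subtopology X W) = W"
    using openV' W(2) openin_subset by fastforce+
  have "g ` topspace (subtopology X W) = topspace (subtopology E V')"
    using g by (metis homeomorphic_maps_map homeomorphic_imp_surjective_map)
  then have "g ` W = V'" by (simp only: tV tW)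
  moreover have "path_connectedin (subtopology E V') (g ` W)"
    using g W(3) unfolding homeomorphic_maps_def
    by (intro path_connectedin_continuous_map_image[of "subtopology X W"])
      (auto simp: path_connectedin_subtopology)
  ultimately have "path_connectedin E V'"
    by (simp add: path_connectedin_subtopology)
  then have 1: "V' \<subseteq> sheet E p W e"
    using e Ve by (intro path_connectedin_subset_sheet) (auto simp: V'_def)
  have "closedin (subtopology E ?P) V'"
  proof -
    have "?P - V' = ?P \<inter> \<Union>(\<V> - {V})"
      using V(1,3) Ve W(1) by (auto simp: V'_def pairwise_def disjnt_def)
    moreover have "openin E (\<Union>(\<V> - {V}))"
      using V(2) by blast
    ultimately have "openin (subtopology E ?P) (?P - V')"
      by (simp add: openin_subtopology_Int2)
    moreover have "V' \<subseteq> ?P" by (auto simp: V'_def)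
    ultimately show ?thesis
      by (simp add: closedin_def Int_absorb1)
  qed
  moreover have "openin (subtopology E ?P) V'"
    using openV' by (simp add: V'_def openP openin_open_subtopology)
  moreover have "connectedin (subtopology E ?P) (sheet E p W e)"
    unfolding sheet_def
    by (intro path_connectedin_imp_connectedin path_connectedin_path_component_of)
  ultimately have "sheet E p W e \<subseteq> V' \<or> disjnt (sheet E p W e) V'"
    by (intro connectedin_clopen_cases)
  moreover have "e \<in> V'" "e \<in> sheet E p W e"
    using e Ve by (auto simp: V'_def sheet_self)
  ultimately have "sheet E p W e = V'"
    using 1 by (auto simp: disjnt_def)
  then show "openin E (sheet E p W e)" "bij_betw p (sheet E p W e) W"
    using openV' bijV' by auto
qed

lemma evenly_covered_if_sheeted:
  assumes "sheeted E X p U"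
  shows "evenly_covered E p U"
  unfolding evenly_covered_def
proof (intro exI conjI)
  let ?\<V> = "sheet E p U ` {e \<in> topspace E. p e \<in> U}"
  have "e \<in> sheet E p U e" if "e \<in> topspace E" "p e \<in> U" for e
    using that by (simp add: sheet_self)
  then show "\<Union>?\<V> = {e \<in> topspace E. p e \<in> U}"
    by (auto dest: in_sheetD)
  show "\<forall>V\<in>?\<V>. openin E V \<and> bij_betw p V U"
    using assms by (auto simp: sheeted_def)
  show "pairwise disjnt ?\<V>"
    unfolding pairwise_def disjnt_iff by (auto dest: sheet_eq)
qed

lemma sheeted_inj:
  assumes "sheeted E X p U" "a \<in> sheet E p U e" "b \<in> sheet E p U e" "p a = p b"
  shows "a = b"
proof -
  have "bij_betw p (sheet E p U e) U"
    using assms(1) in_sheetD[OF assms(2)] by (simp add: sheeted_def)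
  then show ?thesis
    using assms by (meson bij_betw_imp_inj_on inj_onD)
qed

lemma sheeted_lift:
  assumes "sheeted E X p U" "e \<in> topspace E" "p e \<in> U" "y \<in> U"
  shows "\<exists>b\<in>sheet E p U e. p b = y"
proof -
  have "bij_betw p (sheet E p U e) U"
    using assms by (simp add: sheeted_def)
  then show ?thesis
    using assms(4) by (metis bij_betw_imp_surj_on imageE)
qed

lemma sheeted_basis:
  assumes "partial_covering E X p" "locally_path_connected_space X" "openin X W" "x \<in> W"
  shows "\<exists>U. x \<in> U \<and> U \<subseteq> W \<and> path_connectedin X U \<and> sheeted E X p U"
proof -
  note c = partial_coveringD[OF assms(1)]
  obtain U where U: "x \<in> U" "openin X U" "evenly_covered E p U"
    using c(4) assms openin_subset by blast
  obtain U' where "openin X U'" "path_connectedin X U'" "x \<in> U'" "U' \<subseteq> U \<inter> W"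
    using assms U locally_path_connected_space[of X]
    by (metis IntI openin_Int)
  then show ?thesis
    using sheeted_of_evenly_covered[OF c(1,2) U(3)] by blast
qed

lemma sheeted_subset:
  assumes "partial_covering E X p" "sheeted E X p U" "W \<subseteq> U" "openin X W" "path_connectedin X W"
  shows "sheeted E X p W"
  by (rule sheeted_of_evenly_covered[OF partial_coveringD(1,2)[OF assms(1)]
        evenly_covered_if_sheeted[OF assms(2)] assms(3-5)])

section \<open>Morphisms of coverings, components, and realisation in the point type\<close>

lemma sheeted_basis2:
  assumes "partial_covering E X p" "partial_covering E' X p'" "locally_path_connected_space X"
    "x \<in> topspace X"
  shows "\<exists>U. x \<in> U \<and> sheeted E X p U \<and> sheeted E' X p' U"
proof -
  obtain U where U: "x \<in> U" "sheeted E X p U"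
    using sheeted_basis[OF assms(1,3) openin_topspace assms(4)] by blast
  then have "openin X U" by (simp add: sheeted_def)
  then obtain W where W: "x \<in> W" "W \<subseteq> U" "path_connectedin X W" "sheeted E' X p' W"
    using sheeted_basis[OF assms(2,3) _ U(1)] by blast
  moreover have "openin X W" using W(4) by (simp add: sheeted_def)
  ultimately show ?thesis
    using sheeted_subset[OF assms(1) U(2)] by blast
qed

text \<open>The set where two lifts agree is open, because both lifts run in the same slice near an
  agreement point, and closed, because they run in disjoint slices near a disagreement point.\<close>

lemma lift_unique:
  assumes p: "partial_covering E X p" and Z: "connected_space Z"
    and fg: "continuous_map Z E f" "continuous_map Z E g"
      "\<And>z. z \<in> topspace Z \<Longrightarrow> p (f z) = p (g z)"
    and z0: "z0 \<in> topspace Z" "f z0 = g z0" and z: "z \<in> topspace Z"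
  shows "f z = g z"
proof -
  define A where "A = {z \<in> topspace Z. f z = g z}"
  have nbhd: "\<exists>B. openin Z B \<and> z \<in> B \<and> (\<forall>w\<in>B. f w = g w \<longleftrightarrow> f z = g z)"
    if z: "z \<in> topspace Z" for z
  proof -
    have fz: "f z \<in> topspace E" "g z \<in> topspace E" "p (f z) \<in> topspace X"
      using fg(1,2) z partial_coveringD(3)[OF p] by (auto simp: continuous_map_def Pi_iff)
    obtain U where U: "p (f z) \<in> U" "evenly_covered E p U"
      using partial_coveringD(4)[OF p fz(3)] by blast
    then obtain \<V> where V: "\<Union>\<V> = {e \<in> topspace E. p e \<in> U}"
        "\<forall>V\<in>\<V>. openin E V \<and> bij_betw p V U" "pairwise disjnt \<V>"
      unfolding evenly_covered_def by (elim exE conjE) (rule that, assumption+)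
    have "f z \<in> \<Union>\<V>" "g z \<in> \<Union>\<V>"
      using V(1) fz U(1) fg(3)[OF z] by auto
    then obtain V V' where VV: "V \<in> \<V>" "f z \<in> V" "V' \<in> \<V>" "g z \<in> V'"
      by blast
    define B where "B = {w \<in> topspace Z. f w \<in> V} \<inter> {w \<in> topspace Z. g w \<in> V'}"
    have "openin Z B"
      unfolding B_def using V(2) VV fg by (intro openin_Int openin_continuous_map_preimage) auto
    moreover have "z \<in> B" using z VV by (simp add: B_def)
    moreover have "f w = g w \<longleftrightarrow> f z = g z" if w: "w \<in> B" for w
    proof (cases "V = V'")
      case True
      have "inj_on p V" using V(2) VV by (simp add: bij_betw_def)
      moreover have "p (f w) = p (g w)" "f w \<in> V" "g w \<in> V" using w True fg(3) by (auto simp: B_def)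
      ultimately show ?thesis
        using True VV fg(3)[OF z] by (auto dest: inj_onD)
    next
      case False
      then have "V \<inter> V' = {}" using V(3) VV by (simp add: pairwise_def disjnt_def)
      then show ?thesis using w VV by (auto simp: B_def)
    qed
    ultimately show ?thesis by blast
  qed
  have "openin Z A"
  proof (subst openin_subopen, intro ballI)
    fix z assume "z \<in> A"
    then obtain B where "openin Z B" "z \<in> B" "\<forall>w\<in>B. f w = g w"
      using nbhd[of z] by (auto simp: A_def)
    then show "\<exists>T. openin Z T \<and> z \<in> T \<and> T \<subseteq> A"
      using openin_subset[of Z B] by (auto simp: A_def)
  qed
  moreover have "openin Z (topspace Z - A)"
  proof (subst openin_subopen, intro ballI)
    fix z assume "z \<in> topspace Z - A"
    then obtain B where "openin Z B" "z \<in> B" "\<forall>w\<in>B. f w \<noteq> g w"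
      using nbhd[of z] by (auto simp: A_def)
    then show "\<exists>T. openin Z T \<and> z \<in> T \<and> T \<subseteq> topspace Z - A"
      using openin_subset[of Z B] by (auto simp: A_def)
  qed
  then have "closedin Z A"
    by (simp add: closedin_def A_def)
  ultimately have "A = {} \<or> A = topspace Z"
    using Z by (simp add: connected_space_clopen_in)
  then show ?thesis using z0 z by (auto simp: A_def)
qed

text \<open>Over an open set that is sheeted for both coverings, a morphism maps a sheet into a sheet
  because sheets are path components, and both sheets are copies of the base set. So it maps sheets
  bijectively onto sheets, and the sheets of \<open>E\<close> above one sheet of \<open>E'\<close> are its slices.\<close>

lemma covering_map_morphism:
  assumes p: "partial_covering E X p" and p': "partial_covering E' X p'"
    and X: "locally_path_connected_space X"
    and f: "continuous_map E E' f" "\<And>e. e \<in> topspace E \<Longrightarrow> p' (f e) = p e"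
      "f ` topspace E = topspace E'"
  shows "covering_map E E' f"
proof -
  have fE: "f e \<in> topspace E'" if "e \<in> topspace E" for e
    using f(3) that by blast
  have f_sheet: "f ` sheet E p U e \<subseteq> sheet E' p' U (f e)"
    if "e \<in> topspace E" "p e \<in> U" for U e
  proof (rule path_connectedin_subset_sheet)
    show "path_connectedin E' (f ` sheet E p U e)"
      using f(1) path_connectedin_sheet by (rule path_connectedin_continuous_map_image)
    show "f e \<in> f ` sheet E p U e" using that by (simp add: sheet_self)
    show "p' ` f ` sheet E p U e \<subseteq> U"
      using f(2) in_sheetD by fastforce
  qed
  have bij: "bij_betw f (sheet E p U e) (sheet E' p' U (f e))"
    if U: "sheeted E X p U" "sheeted E' X p' U" and e: "e \<in> topspace E" "p e \<in> U" for U e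
    unfolding bij_betw_def
  proof (intro conjI inj_onI equalityI f_sheet e subsetI)
    fix a b assume ab: "a \<in> sheet E p U e" "b \<in> sheet E p U e" "f a = f b"
    then have "p a = p b" using f(2) in_sheetD by metis
    then show "a = b" using sheeted_inj[OF U(1)] ab by blast
  next
    fix b assume b: "b \<in> sheet E' p' U (f e)"
    then have "p' b \<in> U" using in_sheetD by fast
    then obtain v where v: "v \<in> sheet E p U e" "p v = p' b"
      using sheeted_lift[OF U(1) e] by blast
    then have "f v \<in> sheet E' p' U (f e)" "p' (f v) = p' b"
      using f_sheet[OF e] f(2) in_sheetD[OF v(1)] by auto
    then have "b = f v" using sheeted_inj[OF U(2) b] by metis
    then show "b \<in> f ` sheet E p U e" using v by blast
  qed
  have "open_map E E' f"
    unfolding open_map_def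
  proof (intro allI impI)
    fix S assume S: "openin E S"
    show "openin E' (f ` S)"
    proof (subst openin_subopen, intro ballI)
      fix y assume "y \<in> f ` S"
      then obtain e where e: "e \<in> S" "y = f e" by blast
      then have eE: "e \<in> topspace E" using S openin_subset by blast
      obtain U where U: "p e \<in> U" "sheeted E X p U" "sheeted E' X p' U"
        using sheeted_basis2[OF p p' X partial_coveringD(3)[OF p eE]] by blast
      define V where "V = sheet E p U e \<inter> S"
      have "openin E V" using U eE S by (auto simp: V_def sheeted_def)
      then have "openin X (p ` V)"
        using partial_coveringD(2)[OF p] by (simp add: open_map_def)
      then have o: "openin E' (sheet E' p' U (f e) \<inter> {b \<in> topspace E'. p' b \<in> p ` V})"
        using U(1,3) fE[OF eE] f(2)[OF eE] partial_coveringD(1)[OF p']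
        by (intro openin_Int openin_continuous_map_preimage) (auto simp: sheeted_def)
      have "b \<in> f ` S" if b: "b \<in> sheet E' p' U (f e)" "p' b \<in> p ` V" for b
      proof -
        obtain v where v: "v \<in> V" "p' b = p v" using b by blast
        obtain w where w: "w \<in> sheet E p U e" "b = f w"
          using bij[OF U(2,3) eE U(1)] b(1) unfolding bij_betw_def by blast
        have "p w = p v" using v w f(2) in_sheetD[OF w(1)] by simp
        then have "w = v" using sheeted_inj[OF U(2) w(1)] v by (simp add: V_def)
        then show ?thesis using w v by (simp add: V_def)
      qed
      moreover have "y \<in> sheet E' p' U (f e) \<inter> {b \<in> topspace E'. p' b \<in> p ` V}"
        using e U eE f(2)[OF eE] fE[OF eE] by (auto simp: sheet_self V_def)
      ultimately show "\<exists>T. openin E' T \<and> y \<in> T \<and> T \<subseteq> f ` S"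
        using o by blast
    qed
  qed
  moreover have "\<exists>W. b \<in> W \<and> openin E' W \<and> evenly_covered E f W" if b: "b \<in> topspace E'" for b
  proof -
    obtain U where U: "p' b \<in> U" "sheeted E X p U" "sheeted E' X p' U"
      using sheeted_basis2[OF p p' X partial_coveringD(3)[OF p' b]] by blast
    let ?W = "sheet E' p' U b" and ?\<V> = "sheet E p U ` {e \<in> topspace E. f e \<in> sheet E' p' U b}"
    have over: "p e \<in> U" "sheet E' p' U (f e) = ?W" if "e \<in> topspace E" "f e \<in> ?W" for e
      using that f(2) in_sheetD sheet_eq by metis+
    have "evenly_covered E f ?W"
      unfolding evenly_covered_def
    proof (intro exI conjI)
      have "e \<in> sheet E p U e" if "e \<in> topspace E" "f e \<in> ?W" for e
        using that over by (simp add: sheet_self)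
      moreover have "z \<in> topspace E \<and> f z \<in> ?W"
        if "e \<in> topspace E" "f e \<in> ?W" "z \<in> sheet E p U e" for e z
        using f_sheet[of e U] over[of e] that in_sheetD[OF that(3)] by blast
      ultimately show "\<Union>?\<V> = {e \<in> topspace E. f e \<in> ?W}"
        by blast
      show "\<forall>V\<in>?\<V>. openin E V \<and> bij_betw f V ?W"
      proof clarsimp
        fix e assume e: "e \<in> topspace E" "f e \<in> ?W"
        then show "openin E (sheet E p U e) \<and> bij_betw f (sheet E p U e) ?W"
          using over[OF e] bij[OF U(2,3) e(1)] U(2) by (simp add: sheeted_def)
      qed
      show "pairwise disjnt ?\<V>"
        unfolding pairwise_def disjnt_iff by (auto dest: sheet_eq)
    qed
    moreover have "openin E' ?W" "b \<in> ?W"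
      using U b by (auto simp: sheeted_def sheet_self)
    ultimately show ?thesis by blast
  qed
  ultimately show ?thesis
    using f by (simp add: covering_map_iff partial_covering_def)
qed

lemma homeomorphic_map_if_injective_covering_map:
  assumes "covering_map E X p" "inj_on p (topspace E)"
  shows "homeomorphic_map E X p"
  using assms by (intro bijective_open_imp_homeomorphic_map)
    (auto simp: covering_map_iff partial_covering_def)

text \<open>A component is a union of sheets. It surjects onto the connected base because its image is open
  and, a sheet covering all of \<open>U\<close> as soon as it meets the preimage of \<open>U\<close>, also closed.\<close>

lemma covering_map_path_component:
  fixes \<pi> :: "'b \<Rightarrow> 'a"
  assumes p: "partial_covering S X \<pi>" and X: "locally_path_connected_space X" "connected_space X"
    and d: "d \<in> topspace S"
  defines "D \<equiv> path_component_of_set S d"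
  shows "covering_map (subtopology S D) X \<pi>"
proof -
  have sheet_D: "sheet S \<pi> U e \<subseteq> D" if "e \<in> D" for U e
  proof -
    have "path_component_of S d z" if "z \<in> sheet S \<pi> U e" for z
    proof -
      have "path_component_of S e z"
        using path_connectedin_sheet[of S \<pi> U e] that in_sheetD[OF that] path_component_of[of S e z]
        by (meson sheet_self)
      then show ?thesis using \<open>e \<in> D\<close> path_component_of_trans unfolding D_def by fast
    qed
    then show ?thesis by (auto simp: D_def)
  qed
  have DS: "D \<subseteq> topspace S" by (simp add: D_def path_component_of_subset_topspace)
  have dD: "d \<in> D" using d by (simp add: D_def path_component_of_refl)
  have basis: "\<exists>U. x \<in> U \<and> openin X U \<and> sheeted S X \<pi> U" if "x \<in> topspace X" for x
    using sheeted_basis[OF p X(1) openin_topspace that] by (auto simp: sheeted_def)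
  have openD: "openin S D"
  proof (subst openin_subopen, intro ballI)
    fix e assume e: "e \<in> D"
    then have eS: "e \<in> topspace S" using DS by blast
    obtain U where U: "\<pi> e \<in> U" "sheeted S X \<pi> U"
      using basis[OF partial_coveringD(3)[OF p eS]] by blast
    then have "openin S (sheet S \<pi> U e)" "e \<in> sheet S \<pi> U e"
      using eS by (auto simp: sheeted_def sheet_self)
    then show "\<exists>T. openin S T \<and> e \<in> T \<and> T \<subseteq> D"
      using sheet_D[OF e] by blast
  qed
  have "open_map (subtopology S D) X \<pi>"
    using partial_coveringD(2)[OF p] openD by (auto simp: open_map_def openin_open_subtopology)
  moreover have "continuous_map (subtopology S D) X \<pi>"
    using partial_coveringD(1)[OF p] by (rule continuous_map_from_subtopology)
  moreover have "\<exists>U. x \<in> U \<and> openin X U \<and> evenly_covered (subtopology S D) \<pi> U"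
    if x: "x \<in> topspace X" for x
  proof -
    obtain U where U: "x \<in> U" "openin X U" "sheeted S X \<pi> U"
      using basis[OF x] by blast
    let ?\<V> = "sheet S \<pi> U ` {e \<in> D. \<pi> e \<in> U}"
    have "evenly_covered (subtopology S D) \<pi> U"
      unfolding evenly_covered_def
    proof (intro exI conjI)
      have "e \<in> sheet S \<pi> U e" if "e \<in> D" "\<pi> e \<in> U" for e
        using that DS by (auto simp: sheet_self)
      moreover have "z \<in> D \<and> \<pi> z \<in> U" if "e \<in> D" "z \<in> sheet S \<pi> U e" for e z
        using that sheet_D in_sheetD[OF that(2)] by blast
      moreover have "topspace (subtopology S D) = D" using DS by auto
      ultimately show "\<Union>?\<V> = {e \<in> topspace (subtopology S D). \<pi> e \<in> U}"
        by blast
      show "\<forall>V\<in>?\<V>. openin (subtopology S D) V \<and> bij_betw \<pi> V U"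
        using U(3) DS openD sheet_D by (auto simp: sheeted_def openin_open_subtopology)
      show "pairwise disjnt ?\<V>"
        unfolding pairwise_def disjnt_iff by (auto dest: sheet_eq)
    qed
    then show ?thesis using U by blast
  qed
  moreover have "\<pi> ` D = topspace X"
  proof -
    have 1: "openin X (\<pi> ` D)"
      using partial_coveringD(2)[OF p] openD by (simp add: open_map_def)
    have "openin X (topspace X - \<pi> ` D)"
    proof (subst openin_subopen, intro ballI)
      fix x assume x: "x \<in> topspace X - \<pi> ` D"
      then obtain U where U: "x \<in> U" "openin X U" "sheeted S X \<pi> U"
        using basis by blast
      have "x \<in> \<pi> ` D" if "e \<in> D" "\<pi> e \<in> U" for e
        using sheeted_lift[OF U(3) _ that(2) U(1)] sheet_D[OF that(1), of U] that(1) DS by blast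
      then have "U \<inter> \<pi> ` D = {}" using x by blast
      then show "\<exists>T. openin X T \<and> x \<in> T \<and> T \<subseteq> topspace X - \<pi> ` D"
        using U(1,2) openin_subset[OF U(2)] by (intro exI[of _ U]) blast
    qed
    then have "closedin X (\<pi> ` D)"
      using openin_subset[OF 1] by (simp add: closedin_def)
    then show ?thesis
      using X(2) 1 dD by (auto simp: connected_space_clopen_in)
  qed
  moreover have "topspace (subtopology S D) = D" using DS by auto
  ultimately show ?thesis
    by (simp add: covering_map_iff partial_covering_def)
qed

lemma covering_map_homeomorphic_source:
  assumes p: "covering_map E X p" and \<psi>: "homeomorphic_map Z E \<psi>"
  shows "covering_map Z X (p \<circ> \<psi>)"
proof -
  have cp: "partial_covering E X p" "p ` topspace E = topspace X"
    using p by (auto simp: covering_map_iff)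
  have cont: "continuous_map Z E \<psi>" and op: "open_map Z E \<psi>" and inj: "inj_on \<psi> (topspace Z)"
    and surj: "\<psi> ` topspace Z = topspace E"
    using \<psi> by (auto simp: homeomorphic_imp_continuous_map homeomorphic_imp_open_map
        homeomorphic_imp_injective_map homeomorphic_imp_surjective_map)
  have "evenly_covered Z (p \<circ> \<psi>) U" if U: "evenly_covered E p U" for U
  proof -
    obtain \<V> where V: "\<Union>\<V> = {e \<in> topspace E. p e \<in> U}"
        "\<forall>V\<in>\<V>. openin E V \<and> bij_betw p V U" "pairwise disjnt \<V>"
      using U unfolding evenly_covered_def by (elim exE conjE) (rule that, assumption+)
    let ?pre = "\<lambda>V. {z \<in> topspace Z. \<psi> z \<in> V}"
    have "bij_betw (p \<circ> \<psi>) (?pre V) U" if "V \<in> \<V>" for V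
    proof (rule bij_betw_trans)
      have "V \<subseteq> topspace E" using V(2) that openin_subset by blast
      then have "\<psi> ` ?pre V = V" unfolding surj[symmetric] by blast
      then show "bij_betw \<psi> (?pre V) V"
        using inj by (auto simp: bij_betw_def inj_on_def)
    qed (use V that in auto)
    moreover have "openin Z (?pre V)" if "V \<in> \<V>" for V
      using V(2) that cont by (auto intro: openin_continuous_map_preimage)
    moreover have "\<Union>(?pre ` \<V>) = {z \<in> topspace Z. (p \<circ> \<psi>) z \<in> U}"
    proof -
      have "\<psi> z \<in> \<Union>\<V> \<longleftrightarrow> p (\<psi> z) \<in> U" if "z \<in> topspace Z" for z
        using V(1) surj that by auto
      then show ?thesis by auto
    qed
    moreover have "pairwise disjnt (?pre ` \<V>)"
      using V(3) unfolding pairwise_def disjnt_iff by blast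
    ultimately show ?thesis
      unfolding evenly_covered_def by (intro exI[of _ "?pre ` \<V>"]) auto
  qed
  then have "\<exists>U. x \<in> U \<and> openin X U \<and> evenly_covered Z (p \<circ> \<psi>) U" if "x \<in> topspace X" for x
    using partial_coveringD(4)[OF cp(1) that] by blast
  moreover have "continuous_map Z X (p \<circ> \<psi>)" "open_map Z X (p \<circ> \<psi>)"
    using cont op partial_coveringD(1,2)[OF cp(1)]
    by (auto intro: continuous_map_compose open_map_compose)
  moreover have "(p \<circ> \<psi>) ` topspace Z = topspace X"
    using surj cp(2) by (metis image_comp)
  ultimately show ?thesis
    by (simp add: covering_map_iff partial_covering_def)
qed

text \<open>A point \<open>y\<close> is encoded by the set of all projections of paths from a base point to \<open>y\<close>; unique
  lifting of paths makes this encoding injective. It allows universal properties, which quantify only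
  over covering spaces with this point type, to be applied to covering spaces with any point type.\<close>

lemma cover_point_realisation:
  fixes Cv :: "('b, 'a) cover" and m :: "'a metric"
  assumes Cv: "is_cover m Cv" "path_connected_space (total Cv)" "topspace (total Cv) \<noteq> {}"
  obtains Z :: "('a cover_point, 'a) cover" and \<psi>
  where "is_cover m Z" "homeomorphic_map (total Z) (total Cv) \<psi>"
    "\<And>z. z \<in> topspace (total Z) \<Longrightarrow> proj Cv (\<psi> z) = proj Z z"
proof -
  obtain E q where E: "Cv = (E, q)" by (cases Cv)
  obtain y0 where y0: "y0 \<in> topspace E" using Cv(3) unfolding E fst_conv by blast
  define \<phi> where "\<phi> y = {q \<circ> \<gamma> |\<gamma>. pathin E \<gamma> \<and> \<gamma> 0 = y0 \<and> \<gamma> 1 = y}" for y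
  have p: "partial_covering E (mtopology_of m) q" and cov: "covering_map E (mtopology_of m) q"
    using Cv E by (auto simp: is_cover_def covering_map_iff)
  have inj: "inj_on \<phi> (topspace E)"
  proof (rule inj_onI)
    fix y y' assume y: "y \<in> topspace E" "y' \<in> topspace E" "\<phi> y = \<phi> y'"
    obtain \<gamma> where \<gamma>: "pathin E \<gamma>" "\<gamma> 0 = y0" "\<gamma> 1 = y"
      using Cv(2) y0 y(1) unfolding E fst_conv path_connected_space_def by blast
    then have "q \<circ> \<gamma> \<in> \<phi> y'" using y(3) by (auto simp: \<phi>_def)
    then obtain \<gamma>' where \<gamma>': "pathin E \<gamma>'" "\<gamma>' 0 = y0" "\<gamma>' 1 = y'" "q \<circ> \<gamma> = q \<circ> \<gamma>'"
      by (auto simp: \<phi>_def)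
    let ?I = "top_of_set {0..1::real}"
    have "connected_space ?I" "0 \<in> topspace ?I" "1 \<in> topspace ?I"
      by (auto simp: connected_space_subtopology)
    moreover have "continuous_map ?I E \<gamma>" "continuous_map ?I E \<gamma>'"
      using \<gamma> \<gamma>' by (auto simp: pathin_def)
    moreover have "q (\<gamma> z) = q (\<gamma>' z)" for z
      using fun_cong[OF \<gamma>'(4), of z] by simp
    moreover have "\<gamma> 0 = \<gamma>' 0" using \<gamma> \<gamma>' by simp
    ultimately have "\<gamma> 1 = \<gamma>' 1"
      using lift_unique[OF p, of ?I \<gamma> \<gamma>' 0 1] by blast
    then show "y = y'" using \<gamma> \<gamma>' by simp
  qed
  have "homeomorphic_map E (quotient_topology E \<phi>) \<phi>"
    by (simp add: homeomorphic_map_def inj quotient_map_quotient_topology)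
  then obtain \<psi> where \<psi>: "homeomorphic_map (quotient_topology E \<phi>) E \<psi>"
    by (metis homeomorphic_map_maps homeomorphic_maps_map)
  show ?thesis
  proof (rule that[of "(quotient_topology E \<phi>, q \<circ> \<psi>)" \<psi>])
    have "connected_space (quotient_topology E \<phi>)"
      using Cv(1) E \<psi> by (metis fst_conv homeomorphic_connected_space homeomorphic_map_imp_homeomorphic_space is_cover_def)
    then show "is_cover m (quotient_topology E \<phi>, q \<circ> \<psi>)"
      using covering_map_homeomorphic_source[OF cov \<psi>] by (simp add: is_cover_def)
  qed (use \<psi> E in auto)
qed

section \<open>Length spaces and quotients by deck transformations\<close>

text \<open>Balls are path connected: no point of a minimizing curve from the centre to \<open>y\<close> is farther from
  the centre than \<open>y\<close> is.\<close>

lemma locally_path_connected_space_length_space: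
  assumes m: "complete_length_space m"
  shows "locally_path_connected_space (mtopology_of m)"
proof -
  interpret Metric_space "mspace m" "mdist m" by (rule Metric_space_mspace_mdist)
  have top: "mtopology_of m = mtopology" by (simp add: mtopology_of_def)
  show ?thesis
    unfolding locally_path_connected_space top
  proof (intro allI impI)
    fix V x assume "openin mtopology V \<and> x \<in> V"
    then obtain r where r: "r > 0" "mball x r \<subseteq> V" and x: "x \<in> mspace m"
      using openin_mtopology by blast
    let ?B = "mball x r"
    have comp: "path_component_of (subtopology mtopology ?B) x y" if y: "y \<in> ?B" for y
    proof -
      have y': "y \<in> mspace m" "mdist m x y < r" using y by auto
      obtain \<gamma> where \<gamma>: "pathin mtopology \<gamma>" "\<gamma> 0 = x" "\<gamma> 1 = y"
          "curve_length m \<gamma> = ennreal (mdist m x y)"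
        using m x y'(1) unfolding complete_length_space_def top by blast
      have "\<gamma> t \<in> ?B" if t: "t \<in> {0..1}" for t
      proof -
        have "ennreal (mdist m (\<gamma> 0) (\<gamma> t)) \<le> curve_length m \<gamma>"
          \<comment> \<open>compare with the one-step partition \<open>0 \<le> t\<close>\<close>
          unfolding curve_length_def by (rule SUP_upper2[of "[0, t]"]) (use t in auto)
        then have "mdist m x (\<gamma> t) \<le> mdist m x y"
          using \<gamma> by (simp add: ennreal_le_iff)
        moreover have "\<gamma> t \<in> mspace m"
          using path_image_subset_topspace[OF \<gamma>(1)] t by auto
        ultimately show ?thesis using x y' by simp
      qed
      then have "pathin (subtopology mtopology ?B) \<gamma>"
        using \<gamma>(1) by (simp add: pathin_subtopology)
      then show ?thesis using \<gamma> unfolding path_component_of_def by blast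
    qed
    have "path_component_of (subtopology mtopology ?B) y z" if "y \<in> ?B" "z \<in> ?B" for y z
      using comp[OF that(1)] comp[OF that(2)] path_component_of_sym path_component_of_trans by metis
    moreover have sub: "?B \<subseteq> topspace mtopology" by auto
    ultimately have "path_connectedin mtopology ?B"
      unfolding path_connectedin_def path_connected_space_iff_path_component by auto
    then show "\<exists>U. openin mtopology U \<and> path_connectedin mtopology U \<and> x \<in> U \<and> U \<subseteq> V"
      using r x by (intro exI[of _ ?B]) auto
  qed
qed

lemma deckD:
  assumes "g \<in> deck C"
  shows "homeomorphic_map (total C) (total C) g" "continuous_map (total C) (total C) g"
    "bij_betw g (topspace (total C)) (topspace (total C))"
    "g \<in> Bij (topspace (total C))"
    "\<And>x. x \<in> topspace (total C) \<Longrightarrow> g x \<in> topspace (total C)"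
    "\<And>x. x \<in> topspace (total C) \<Longrightarrow> proj C (g x) = proj C x"
  using assms by (auto simp: deck_def homeomorphic_imp_continuous_map Bij_def bij_betw_def)

lemma deckI:
  assumes g: "homeomorphic_map (total C) (total C) g"
    and p: "\<And>x. x \<in> topspace (total C) \<Longrightarrow> proj C (g x) = proj C x"
  shows "restrict g (topspace (total C)) \<in> deck C"
proof -
  have "bij_betw g (topspace (total C)) (topspace (total C))"
    using g by (simp add: bij_betw_def homeomorphic_imp_injective_map homeomorphic_imp_surjective_map)
  then have "restrict g (topspace (total C)) \<in> Bij (topspace (total C))"
    by (simp add: Bij_def cong: bij_betw_cong)
  moreover have "homeomorphic_map (total C) (total C) (restrict g (topspace (total C)))"
    using g by (rule homeomorphic_map_eq) simp
  ultimately show ?thesis using p by (simp add: deck_def)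
qed

lemma carrier_deck_group [simp]: "carrier (deck_group C) = deck C"
  by (simp add: deck_group_def)

lemma deck_group_mult_apply:
  assumes "g \<in> deck C" "h \<in> deck C" "x \<in> topspace (total C)"
  shows "(g \<otimes>\<^bsub>deck_group C\<^esub> h) x = g (h x)"
  using assms deckD(4)[of g C] deckD(4)[of h C]
  by (simp add: deck_group_def BijGroup_def compose_def)

lemma deck_group_one_apply: "x \<in> topspace (total C) \<Longrightarrow> \<one>\<^bsub>deck_group C\<^esub> x = x"
  by (simp add: deck_group_def BijGroup_def)

lemma deck_group_inv_apply:
  assumes g: "g \<in> deck C" and x: "x \<in> topspace (total C)"
  shows "(inv\<^bsub>deck_group C\<^esub> g) (g x) = x" "g ((inv\<^bsub>deck_group C\<^esub> g) x) = x"
proof -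
  interpret group "deck_group C" by (rule group_deck_group)
  have i: "inv\<^bsub>deck_group C\<^esub> g \<in> deck C" using inv_closed g by simp
  show "(inv\<^bsub>deck_group C\<^esub> g) (g x) = x"
    using deck_group_mult_apply[OF i g x] l_inv g x by (simp add: deck_group_one_apply)
  show "g ((inv\<^bsub>deck_group C\<^esub> g) x) = x"
    using deck_group_mult_apply[OF g i x] r_inv g x by (simp add: deck_group_one_apply)
qed

lemma deck_sheet:
  assumes g: "g \<in> deck C" and e: "e \<in> topspace (total C)" "proj C e \<in> U"
  shows "g ` sheet (total C) (proj C) U e \<subseteq> sheet (total C) (proj C) U (g e)"
proof (rule path_connectedin_subset_sheet)
  show "path_connectedin (total C) (g ` sheet (total C) (proj C) U e)"
    using deckD(2)[OF g] path_connectedin_sheet by (rule path_connectedin_continuous_map_image)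
  show "g e \<in> g ` sheet (total C) (proj C) U e" using e by (simp add: sheet_self)
  show "proj C ` g ` sheet (total C) (proj C) U e \<subseteq> U"
  proof clarify
    fix z assume "z \<in> sheet (total C) (proj C) U e"
    then show "proj C (g z) \<in> U" using deckD(6)[OF g] in_sheetD by fastforce
  qed
qed

abbreviation deck_orbit :: "('b, 'a) cover \<Rightarrow> ('b \<Rightarrow> 'b) set \<Rightarrow> 'b \<Rightarrow> 'b set" where
  "deck_orbit C H \<equiv> orbit (deck_group C \<lparr>carrier := H\<rparr>) (\<lambda>g. g)"

lemma in_deck_orbit: "z \<in> deck_orbit C H e \<longleftrightarrow> (\<exists>h\<in>H. z = h e)"
  by (auto simp: orbit_def)

context
  fixes C :: "('b, 'a) cover" and H :: "('b \<Rightarrow> 'b) set"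
  assumes H: "subgroup H (deck_group C)"
begin

lemma subgroup_deckD:
  shows "h \<in> H \<Longrightarrow> h \<in> deck C"
    and "\<exists>h\<in>H. \<forall>x\<in>topspace (total C). h x = x"
    and "h \<in> H \<Longrightarrow> k \<in> H \<Longrightarrow> \<exists>l\<in>H. \<forall>x\<in>topspace (total C). l x = h (k x)"
    and "h \<in> H \<Longrightarrow> \<exists>k\<in>H. \<forall>x\<in>topspace (total C). k (h x) = x \<and> h (k x) = x"
proof -
  show 1: "h \<in> deck C" if "h \<in> H" for h using subgroup.subset[OF H] that by auto
  show "\<exists>h\<in>H. \<forall>x\<in>topspace (total C). h x = x"
    using subgroup.one_closed[OF H] deck_group_one_apply by metis
  show "\<exists>l\<in>H. \<forall>x\<in>topspace (total C). l x = h (k x)" if "h \<in> H" "k \<in> H"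
    using subgroup.m_closed[OF H that] deck_group_mult_apply[OF 1[OF that(1)] 1[OF that(2)]] by metis
  show "\<exists>k\<in>H. \<forall>x\<in>topspace (total C). k (h x) = x \<and> h (k x) = x" if "h \<in> H"
    using subgroup.m_inv_closed[OF H that] deck_group_inv_apply[OF 1[OF that]] by metis
qed

lemma deck_orbit_eq_iff:
  assumes "x \<in> topspace (total C)" "y \<in> topspace (total C)"
  shows "deck_orbit C H x = deck_orbit C H y \<longleftrightarrow> (\<exists>h\<in>H. y = h x)"
proof
  assume "deck_orbit C H x = deck_orbit C H y"
  moreover have "y \<in> deck_orbit C H y"
    using subgroup_deckD(2) assms(2) unfolding in_deck_orbit by metis
  ultimately have "y \<in> deck_orbit C H x" by simp
  then show "\<exists>h\<in>H. y = h x" by (simp only: in_deck_orbit)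
next
  have sub: "deck_orbit C H (h x) \<subseteq> deck_orbit C H x" if "h \<in> H" "x \<in> topspace (total C)" for h x
  proof
    fix z assume "z \<in> deck_orbit C H (h x)"
    then obtain k where "k \<in> H" "z = k (h x)" by (auto simp: in_deck_orbit)
    then show "z \<in> deck_orbit C H x"
      using subgroup_deckD(3)[of k h] that by (metis in_deck_orbit)
  qed
  assume "\<exists>h\<in>H. y = h x"
  then obtain h where h: "h \<in> H" "y = h x" by blast
  obtain k where k: "k \<in> H" "k y = x" using subgroup_deckD(4)[OF h(1)] h(2) assms(1) by blast
  show "deck_orbit C H x = deck_orbit C H y"
    using sub[OF h(1) assms(1)] sub[OF k(1) assms(2)] h k by auto
qed

lemma total_quotient_cover:
  "total (quotient_cover C H) = quotient_topology (total C) (deck_orbit C H)"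
  by (simp add: quotient_cover_def)

lemma proj_quotient_cover:
  assumes x: "x \<in> topspace (total C)"
  shows "proj (quotient_cover C H) (deck_orbit C H x) = proj C x"
proof -
  have "proj C ` deck_orbit C H x = {proj C x}"
  proof (intro equalityI subsetI)
    fix y assume "y \<in> proj C ` deck_orbit C H x"
    then obtain h where "h \<in> H" "y = proj C (h x)" by (auto simp: in_deck_orbit)
    then show "y \<in> {proj C x}" using deckD(6)[OF subgroup_deckD(1) x] by simp
  next
    fix y assume "y \<in> {proj C x}"
    moreover obtain h where "h \<in> H" "h x = x" using subgroup_deckD(2) x by blast
    ultimately show "y \<in> proj C ` deck_orbit C H x" using in_deck_orbit by (metis imageI singletonD)
  qed
  then show ?thesis by (simp add: quotient_cover_def)
qed

lemma continuous_map_deck_orbit: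
  "continuous_map (total C) (total (quotient_cover C H)) (deck_orbit C H)"
  unfolding total_quotient_cover by (rule quotient_imp_continuous_map[OF quotient_map_quotient_topology])

text \<open>The slices of \<open>C/H\<close> over a sheeted \<open>U\<close> are the images of the sheets of \<open>C\<close>. Deck transformations
  permute sheets, so two such images are equal or disjoint; and they preserve the projection, so it
  stays injective on each image.\<close>

lemma is_cover_quotient_cover:
  assumes C: "is_cover m C" and X: "locally_path_connected_space (mtopology_of m)"
  shows "is_cover m (quotient_cover C H)"
proof -
  let ?E = "total C" and ?p = "proj C" and ?q = "deck_orbit C H" and ?X = "mtopology_of m"
  let ?Q = "total (quotient_cover C H)" and ?p' = "proj (quotient_cover C H)"
  have p: "partial_covering ?E ?X ?p" "?p ` topspace ?E = topspace ?X" "connected_space ?E"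
    using C by (auto simp: is_cover_def covering_map_iff)
  have topQ: "topspace ?Q = ?q ` topspace ?E" by (simp add: total_quotient_cover)
  have openQ: "openin ?Q U \<longleftrightarrow> U \<subseteq> ?q ` topspace ?E \<and> openin ?E {x \<in> topspace ?E. ?q x \<in> U}" for U
    by (simp add: total_quotient_cover openin_quotient_topology)
  have open_q: "openin ?Q (?q ` V)" if V: "openin ?E V" for V
  proof -
    have VE: "V \<subseteq> topspace ?E" using V openin_subset by blast
    have "{x \<in> topspace ?E. ?q x \<in> ?q ` V} = (\<Union>h\<in>H. {x \<in> topspace ?E. h x \<in> V})"
    proof (intro equalityI subsetI)
      fix x assume "x \<in> {x \<in> topspace ?E. ?q x \<in> ?q ` V}"
      then obtain v where "x \<in> topspace ?E" "v \<in> V" "?q x = ?q v" by blast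
      then show "x \<in> (\<Union>h\<in>H. {x \<in> topspace ?E. h x \<in> V})"
        using deck_orbit_eq_iff[of x v] VE by auto
    next
      fix x assume "x \<in> (\<Union>h\<in>H. {x \<in> topspace ?E. h x \<in> V})"
      then obtain h where "x \<in> topspace ?E" "h \<in> H" "h x \<in> V" by blast
      then show "x \<in> {x \<in> topspace ?E. ?q x \<in> ?q ` V}"
        using deck_orbit_eq_iff[of x "h x"] VE by blast
    qed
    moreover have "openin ?E {x \<in> topspace ?E. h x \<in> V}" if "h \<in> H" for h
      using deckD(2)[OF subgroup_deckD(1)[OF that]] V by (rule openin_continuous_map_preimage)
    ultimately show ?thesis using VE by (auto simp: openQ)
  qed
  have cont: "continuous_map ?Q ?X ?p'"
    unfolding total_quotient_cover
  proof (rule continuous_compose_quotient_map[OF quotient_map_quotient_topology])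
    show "continuous_map ?E ?X (?p' \<circ> ?q)"
      using partial_coveringD(1)[OF p(1)] by (rule continuous_map_eq) (simp add: proj_quotient_cover)
  qed
  have "open_map ?Q ?X ?p'"
    unfolding open_map_def
  proof (intro allI impI)
    fix U assume U: "openin ?Q U"
    have "?p' ` U = ?p ` {x \<in> topspace ?E. ?q x \<in> U}"
    proof (intro equalityI subsetI)
      fix y assume "y \<in> ?p' ` U"
      then obtain x where "x \<in> topspace ?E" "?q x \<in> U" "y = ?p' (?q x)"
        using U by (auto simp: openQ)
      then show "y \<in> ?p ` {x \<in> topspace ?E. ?q x \<in> U}" by (auto simp: proj_quotient_cover)
    next
      fix y assume "y \<in> ?p ` {x \<in> topspace ?E. ?q x \<in> U}"
      then show "y \<in> ?p' ` U" using proj_quotient_cover by force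
    qed
    then show "openin ?X (?p' ` U)"
      using U partial_coveringD(2)[OF p(1)] by (simp add: openQ open_map_def)
  qed
  moreover have "\<exists>U. x \<in> U \<and> openin ?X U \<and> evenly_covered ?Q ?p' U" if x: "x \<in> topspace ?X" for x
  proof -
    obtain U where U: "x \<in> U" "sheeted ?E ?X ?p U"
      using sheeted_basis[OF p(1) X openin_topspace x] by blast
    let ?V = "\<lambda>e. ?q ` sheet ?E ?p U e"
    let ?\<V> = "?V ` {e \<in> topspace ?E. ?p e \<in> U}"
    have V_mono: "?V e \<subseteq> ?V e'"
      if e: "e \<in> topspace ?E" "?p e \<in> U" and h: "h \<in> H" "h e \<in> sheet ?E ?p U e'" for e e' h
    proof (clarify)
      fix z assume z: "z \<in> sheet ?E ?p U e"
      then have "h z \<in> sheet ?E ?p U (h e)"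
        using deck_sheet[OF subgroup_deckD(1)[OF h(1)] e] by blast
      then have hz: "h z \<in> sheet ?E ?p U e'" using sheet_eq[OF h(2)] by simp
      then have "?q z = ?q (h z)"
        using deck_orbit_eq_iff[of z "h z"] in_sheetD[OF z] in_sheetD[OF hz] h(1) by blast
      then show "?q z \<in> ?V e'" using hz by blast
    qed
    have "evenly_covered ?Q ?p' U"
      unfolding evenly_covered_def
    proof (intro exI conjI)
      show "\<Union>?\<V> = {e \<in> topspace ?Q. ?p' e \<in> U}"
      proof (intro equalityI subsetI)
        fix z assume "z \<in> \<Union>?\<V>"
        then obtain e y where "y \<in> sheet ?E ?p U e" "z = ?q y" by blast
        then show "z \<in> {e \<in> topspace ?Q. ?p' e \<in> U}"
          using in_sheetD[of y ?E ?p U e] by (auto simp: topQ proj_quotient_cover)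
      next
        fix z assume "z \<in> {e \<in> topspace ?Q. ?p' e \<in> U}"
        then obtain y where y: "y \<in> topspace ?E" "z = ?q y" "?p y \<in> U"
          by (auto simp: topQ proj_quotient_cover)
        then have "y \<in> sheet ?E ?p U y" by (simp add: sheet_self)
        then show "z \<in> \<Union>?\<V>" using y by blast
      qed
      have "openin ?Q (?V e) \<and> bij_betw ?p' (?V e) U" if e: "e \<in> topspace ?E" "?p e \<in> U" for e
      proof
        have V: "openin ?E (sheet ?E ?p U e)" "bij_betw ?p (sheet ?E ?p U e) U"
          using U(2) e by (auto simp: sheeted_def)
        show "openin ?Q (?V e)" using open_q V by blast
        have eq: "?p' (?q z) = ?p z" if "z \<in> sheet ?E ?p U e" for z
          using in_sheetD[OF that] by (simp add: proj_quotient_cover)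
        have "?p' ` ?V e = ?p ` sheet ?E ?p U e"
          using eq by (force simp: image_image)
        moreover have "inj_on ?p' (?V e)"
          using V(2) eq by (auto simp: inj_on_def bij_betw_def)
        ultimately show "bij_betw ?p' (?V e) U"
          using V(2) by (simp add: bij_betw_def)
      qed
      then show "\<forall>V\<in>?\<V>. openin ?Q V \<and> bij_betw ?p' V U" by blast
      have "?V e = ?V e'" if e: "e \<in> topspace ?E" "?p e \<in> U" "e' \<in> topspace ?E" "?p e' \<in> U"
        and z: "z \<in> ?V e" "z \<in> ?V e'" for e e' z
      proof -
        obtain a b where ab: "a \<in> sheet ?E ?p U e" "b \<in> sheet ?E ?p U e'" "?q a = ?q b"
          using z by auto
        then obtain h where h: "h \<in> H" "b = h a"
          using deck_orbit_eq_iff in_sheetD[OF ab(1)] in_sheetD[OF ab(2)] by blast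
        then obtain k where k: "k \<in> H" "k b = a"
          using subgroup_deckD(4)[OF h(1)] in_sheetD[OF ab(1)] by blast
        have "?V a \<subseteq> ?V e'" "?V b \<subseteq> ?V e"
          using V_mono[of a h e'] V_mono[of b k e] h k ab in_sheetD[OF ab(1)] in_sheetD[OF ab(2)]
          by simp_all
        then show ?thesis using sheet_eq[OF ab(1)] sheet_eq[OF ab(2)] by simp
      qed
      then show "pairwise disjnt ?\<V>"
        unfolding pairwise_def disjnt_iff by blast
    qed
    then show ?thesis using U by (auto simp: sheeted_def)
  qed
  moreover have "?p' ` topspace ?Q = topspace ?X"
    using p(2) by (simp add: topQ image_image proj_quotient_cover)
  ultimately have "covering_map ?Q ?X ?p'"
    using cont by (simp add: covering_map_iff partial_covering_def)
  moreover have "connected_space ?Q"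
    using p(3) quotient_map_quotient_topology connected_space_quotient_map_image
    unfolding total_quotient_cover by metis
  ultimately show ?thesis by (simp add: is_cover_def)
qed

end

text \<open>The morphism sends an \<open>H\<close>-orbit to the \<open>K\<close>-orbit that contains it.\<close>

lemma covers_quotient_covers:
  assumes C: "is_cover m C" and X: "locally_path_connected_space (mtopology_of m)"
    and H: "subgroup H (deck_group C)" and K: "subgroup K (deck_group C)" and HK: "H \<subseteq> K"
  shows "covers (quotient_cover C H) (quotient_cover C K)"
proof -
  let ?E = "total C"
  let ?qH = "deck_orbit C H" and ?qK = "deck_orbit C K"
  have qK: "?qK x = ?qK y" if "x \<in> topspace ?E" "y \<in> topspace ?E" "?qH x = ?qH y" for x y
    using that HK deck_orbit_eq_iff[OF H that(1,2)] deck_orbit_eq_iff[OF K that(1,2)] by blast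
  define f where "f A = ?qK (SOME x. x \<in> topspace ?E \<and> ?qH x = A)" for A
  have f: "f (?qH x) = ?qK x" if x: "x \<in> topspace ?E" for x
  proof -
    let ?y = "SOME y. y \<in> topspace ?E \<and> ?qH y = ?qH x"
    have y: "?y \<in> topspace ?E \<and> ?qH ?y = ?qH x"
      by (rule someI[of _ x]) (use x in simp)
    have "?qK ?y = ?qK x"
      by (rule qK[OF conjunct1[OF y] x conjunct2[OF y]])
    then show ?thesis by (simp only: f_def)
  qed
  have covH: "is_cover m (quotient_cover C H)" and covK: "is_cover m (quotient_cover C K)"
    using is_cover_quotient_cover[OF _ C X] H K by auto
  have tH: "topspace (total (quotient_cover C H)) = ?qH ` topspace ?E"
    and tK: "topspace (total (quotient_cover C K)) = ?qK ` topspace ?E"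
    using total_quotient_cover[OF H] total_quotient_cover[OF K] by simp_all
  have "covering_map (total (quotient_cover C H)) (total (quotient_cover C K)) f"
  proof (rule covering_map_morphism[where X = "mtopology_of m" and p = "proj (quotient_cover C H)"
        and p' = "proj (quotient_cover C K)"])
    show "continuous_map (total (quotient_cover C H)) (total (quotient_cover C K)) f"
      unfolding total_quotient_cover[OF H]
    proof (rule continuous_compose_quotient_map[OF quotient_map_quotient_topology])
      show "continuous_map ?E (total (quotient_cover C K)) (f \<circ> ?qH)"
        using continuous_map_deck_orbit[OF K] by (rule continuous_map_eq) (simp add: f)
    qed
    show "f ` topspace (total (quotient_cover C H)) = topspace (total (quotient_cover C K))"
      using f by (simp add: tH tK image_image)
    show "proj (quotient_cover C K) (f e) = proj (quotient_cover C H) e"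
      if "e \<in> topspace (total (quotient_cover C H))" for e
      using that f proj_quotient_cover[OF H] proj_quotient_cover[OF K] by (auto simp: tH)
  qed (use covH covK X in \<open>auto simp: is_cover_def covering_map_iff\<close>)
  moreover have "\<forall>x\<in>topspace (total (quotient_cover C H)).
      proj (quotient_cover C K) (f x) = proj (quotient_cover C H) x"
    using f proj_quotient_cover[OF H] proj_quotient_cover[OF K] by (auto simp: tH)
  ultimately show ?thesis unfolding covers_def by blast
qed

section \<open>The bundle of frames of a covering\<close>

context
  fixes E :: "'b topology" and X :: "'a topology" and p :: "'b \<Rightarrow> 'a" and c :: 'b
begin

definition base_fibre :: "'b set" where
  "base_fibre = {e \<in> topspace E. p e = p c}"

text \<open>A frame over \<open>x\<close> is a bijection from the fibre over the base point \<open>p c\<close> to the fibre over \<open>x\<close>;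
  the base point \<open>x\<close> is recovered as \<open>p (\<sigma> c)\<close>. Since all sheets over \<open>U\<close> project bijectively to
  \<open>U\<close>, a frame can be transported over \<open>U\<close> in all sheets at once. This makes the set of frames a
  covering of \<open>X\<close> that dominates \<open>p\<close> from every point of the fibre, and on which the permutations of
  the base fibre act by precomposition. The path component of the identity frame is the covering that
  belongs to the intersection of all conjugates of the subgroup of \<open>p\<close>.\<close>

definition frames :: "('b \<Rightarrow> 'b) set" where
  "frames = {\<sigma> \<in> extensional base_fibre.
      bij_betw \<sigma> base_fibre {e \<in> topspace E. p e = p (\<sigma> c)} \<and> \<sigma> c \<in> topspace E}"

definition frame_sheet :: "'a set \<Rightarrow> ('b \<Rightarrow> 'b) \<Rightarrow> ('b \<Rightarrow> 'b) set" where
  "frame_sheet U \<sigma> = {\<tau> \<in> frames. \<forall>e\<in>base_fibre. \<tau> e \<in> sheet E p U (\<sigma> e)}"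

text \<open>The topology with the frame sheets over sheeted sets as a basis. It can be finer than
  pointwise convergence when the fibre is infinite, since one \<open>U\<close> has to serve all points of the fibre.\<close>

definition frame_topology :: "('b \<Rightarrow> 'b) topology" where
  "frame_topology = topology (\<lambda>A. A \<subseteq> frames \<and>
     (\<forall>\<sigma>\<in>A. \<exists>U. p (\<sigma> c) \<in> U \<and> sheeted E X p U \<and> frame_sheet U \<sigma> \<subseteq> A))"

definition frame_proj :: "('b \<Rightarrow> 'b) \<Rightarrow> 'a" where
  "frame_proj \<sigma> = p (\<sigma> c)"

context
  assumes p: "partial_covering E X p" and X: "locally_path_connected_space X"
    and c: "c \<in> topspace E"
begin

lemma frame_sheet_mono: "W \<subseteq> U \<Longrightarrow> frame_sheet W \<sigma> \<subseteq> frame_sheet U \<sigma>"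
  unfolding frame_sheet_def using sheet_mono[of W U E p] by blast

lemma c_in_base_fibre: "c \<in> base_fibre"
  using c by (simp add: base_fibre_def)

lemma frameD:
  assumes "\<sigma> \<in> frames"
  shows "\<sigma> \<in> extensional base_fibre" "bij_betw \<sigma> base_fibre {e \<in> topspace E. p e = p (\<sigma> c)}"
    "\<And>e. e \<in> base_fibre \<Longrightarrow> \<sigma> e \<in> topspace E" "\<And>e. e \<in> base_fibre \<Longrightarrow> p (\<sigma> e) = p (\<sigma> c)"
  using assms by (auto simp: frames_def bij_betw_def)

lemma frame_eqI:
  assumes "\<sigma> \<in> frames" "\<tau> \<in> frames" "\<And>e. e \<in> base_fibre \<Longrightarrow> \<sigma> e = \<tau> e"
  shows "\<sigma> = \<tau>"
  using assms frameD(1) by (metis extensionalityI)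

lemma frame_sheet_self:
  assumes "\<sigma> \<in> frames" "p (\<sigma> c) \<in> U"
  shows "\<sigma> \<in> frame_sheet U \<sigma>"
  using assms frameD[OF assms(1)] by (auto simp: frame_sheet_def sheet_self)

lemma in_frame_sheetD:
  assumes "\<tau> \<in> frame_sheet U \<sigma>"
  shows "\<tau> \<in> frames" "p (\<tau> c) \<in> U" "p (\<sigma> c) \<in> U" "\<And>e. e \<in> base_fibre \<Longrightarrow> \<tau> e \<in> sheet E p U (\<sigma> e)"
  using assms in_sheetD[of "\<tau> c" E p U "\<sigma> c"] c_in_base_fibre by (auto simp: frame_sheet_def)

lemma frame_sheet_eq:
  assumes "\<tau> \<in> frame_sheet U \<sigma>"
  shows "frame_sheet U \<tau> = frame_sheet U \<sigma>"
  using sheet_eq[OF in_frame_sheetD(4)[OF assms]] by (simp add: frame_sheet_def)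

lemma openin_frame_topology:
  "openin frame_topology A \<longleftrightarrow> A \<subseteq> frames \<and>
     (\<forall>\<sigma>\<in>A. \<exists>U. p (\<sigma> c) \<in> U \<and> sheeted E X p U \<and> frame_sheet U \<sigma> \<subseteq> A)"
proof -
  have "istopology (\<lambda>A. A \<subseteq> frames \<and>
     (\<forall>\<sigma>\<in>A. \<exists>U. p (\<sigma> c) \<in> U \<and> sheeted E X p U \<and> frame_sheet U \<sigma> \<subseteq> A))" (is "istopology ?O")
    unfolding istopology_def
  proof (intro conjI allI impI)
    fix A B assume A: "?O A" and B: "?O B"
    show "A \<inter> B \<subseteq> frames" using A by blast
    show "\<forall>\<sigma>\<in>A \<inter> B. \<exists>U. p (\<sigma> c) \<in> U \<and> sheeted E X p U \<and> frame_sheet U \<sigma> \<subseteq> A \<inter> B"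
    proof
      fix \<sigma> assume \<sigma>: "\<sigma> \<in> A \<inter> B"
      obtain U where U: "p (\<sigma> c) \<in> U" "sheeted E X p U" "frame_sheet U \<sigma> \<subseteq> A"
        using A \<sigma> by blast
      obtain V where V: "p (\<sigma> c) \<in> V" "sheeted E X p V" "frame_sheet V \<sigma> \<subseteq> B"
        using B \<sigma> by blast
      have "openin X (U \<inter> V)" "p (\<sigma> c) \<in> U \<inter> V" using U V by (auto simp: sheeted_def)
      then obtain W where W: "p (\<sigma> c) \<in> W" "W \<subseteq> U \<inter> V" "sheeted E X p W"
        using sheeted_basis[OF p X] by metis
      then have "frame_sheet W \<sigma> \<subseteq> A \<inter> B"
        using frame_sheet_mono[of W U \<sigma>] frame_sheet_mono[of W V \<sigma>] U(3) V(3) by blast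
      then show "\<exists>U. p (\<sigma> c) \<in> U \<and> sheeted E X p U \<and> frame_sheet U \<sigma> \<subseteq> A \<inter> B"
        using W by blast
    qed
  next
    fix \<K> assume K: "\<forall>K\<in>\<K>. ?O K"
    show "\<Union>\<K> \<subseteq> frames" using K by blast
    show "\<forall>\<sigma>\<in>\<Union>\<K>. \<exists>U. p (\<sigma> c) \<in> U \<and> sheeted E X p U \<and> frame_sheet U \<sigma> \<subseteq> \<Union>\<K>"
    proof
      fix \<sigma> assume "\<sigma> \<in> \<Union>\<K>"
      then obtain K where K': "K \<in> \<K>" "\<sigma> \<in> K" by blast
      then obtain U where "p (\<sigma> c) \<in> U \<and> sheeted E X p U \<and> frame_sheet U \<sigma> \<subseteq> K"
        using K by meson
      then show "\<exists>U. p (\<sigma> c) \<in> U \<and> sheeted E X p U \<and> frame_sheet U \<sigma> \<subseteq> \<Union>\<K>"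
        using K' by blast
    qed
  qed
  then show ?thesis by (simp add: frame_topology_def topology_inverse')
qed

lemma sheeted_nbhd_frame:
  assumes "\<sigma> \<in> frames"
  shows "\<exists>U. p (\<sigma> c) \<in> U \<and> sheeted E X p U"
proof -
  have "p (\<sigma> c) \<in> topspace X"
    using frameD(3)[OF assms c_in_base_fibre] by (rule partial_coveringD(3)[OF p])
  then show ?thesis using sheeted_basis[OF p X openin_topspace] by meson
qed

lemma topspace_frame_topology [simp]: "topspace frame_topology = frames"
proof
  show "topspace frame_topology \<subseteq> frames"
    using openin_topspace[of frame_topology] unfolding openin_frame_topology by blast
  have "openin frame_topology frames"
    unfolding openin_frame_topology
    using sheeted_nbhd_frame by (auto simp: frame_sheet_def)
  then show "frames \<subseteq> topspace frame_topology" by (rule openin_subset)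
qed

lemma openin_frame_sheet:
  assumes "sheeted E X p U"
  shows "openin frame_topology (frame_sheet U \<sigma>)"
  unfolding openin_frame_topology
proof (intro conjI ballI)
  show "frame_sheet U \<sigma> \<subseteq> frames" by (auto simp: frame_sheet_def)
  fix \<tau> assume \<tau>: "\<tau> \<in> frame_sheet U \<sigma>"
  show "\<exists>U'. p (\<tau> c) \<in> U' \<and> sheeted E X p U' \<and> frame_sheet U' \<tau> \<subseteq> frame_sheet U \<sigma>"
    using assms in_frame_sheetD(2)[OF \<tau>] frame_sheet_eq[OF \<tau>] by blast
qed

text \<open>Each value of \<open>\<sigma>\<close> is moved to the point over \<open>y\<close> in its own sheet. The result is again a frame,
  because transport back to \<open>p (\<sigma> c)\<close> undoes the motion.\<close>

lemma frame_transport: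
  assumes \<sigma>: "\<sigma> \<in> frames" and U: "sheeted E X p U" "p (\<sigma> c) \<in> U" and y: "y \<in> U"
  shows "\<exists>\<tau>\<in>frame_sheet U \<sigma>. p (\<tau> c) = y"
proof -
  have \<sigma>E: "\<sigma> e \<in> topspace E" "p (\<sigma> e) \<in> U" if "e \<in> base_fibre" for e
    using frameD(3,4)[OF \<sigma> that] U(2) by auto
  have "\<exists>b. b \<in> sheet E p U (\<sigma> e) \<and> p b = y" if "e \<in> base_fibre" for e
    using sheeted_lift[OF U(1) \<sigma>E[OF that] y] by blast
  then obtain t where t: "\<And>e. e \<in> base_fibre \<Longrightarrow> t e \<in> sheet E p U (\<sigma> e)"
      "\<And>e. e \<in> base_fibre \<Longrightarrow> p (t e) = y"
    by metis
  define \<tau> where "\<tau> = restrict t base_fibre"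
  have \<tau>: "\<tau> e \<in> sheet E p U (\<sigma> e)" "p (\<tau> e) = y" if "e \<in> base_fibre" for e
    using t that by (auto simp: \<tau>_def)
  have "inj_on \<tau> base_fibre"
  proof (rule inj_onI)
    fix a b assume ab: "a \<in> base_fibre" "b \<in> base_fibre" "\<tau> a = \<tau> b"
    have "sheet E p U (\<sigma> a) = sheet E p U (\<sigma> b)"
      using sheet_eq[OF \<tau>(1)[OF ab(1)]] sheet_eq[OF \<tau>(1)[OF ab(2)]] ab(3) by simp
    moreover have "\<sigma> a \<in> sheet E p U (\<sigma> a)" "\<sigma> b \<in> sheet E p U (\<sigma> b)"
      using \<sigma>E ab by (simp_all add: sheet_self)
    moreover have "p (\<sigma> a) = p (\<sigma> b)" using frameD(4)[OF \<sigma>] ab by simp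
    ultimately have "\<sigma> a = \<sigma> b" using sheeted_inj[OF U(1)] by metis
    then show "a = b" using frameD(2)[OF \<sigma>] ab by (auto simp: bij_betw_def inj_on_def)
  qed
  moreover have "\<tau> ` base_fibre = {e \<in> topspace E. p e = y}"
  proof (intro equalityI subsetI)
    fix z assume "z \<in> \<tau> ` base_fibre"
    then obtain e where e: "e \<in> base_fibre" "z = \<tau> e" by blast
    then show "z \<in> {e \<in> topspace E. p e = y}" using \<tau>[OF e(1)] in_sheetD[OF \<tau>(1)[OF e(1)]] by simp
  next
    fix z assume z: "z \<in> {e \<in> topspace E. p e = y}"
    then obtain a where a: "a \<in> sheet E p U z" "p a = p (\<sigma> c)"
      using sheeted_lift[OF U(1), of z "p (\<sigma> c)"] U(2) y by auto
    then have "a \<in> {e \<in> topspace E. p e = p (\<sigma> c)}" using in_sheetD[OF a(1)] by simp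
    then obtain e where e: "e \<in> base_fibre" "a = \<sigma> e"
      using frameD(2)[OF \<sigma>] by (auto simp: bij_betw_def)
    have "z \<in> sheet E p U (\<sigma> e)" using sheet_sym[OF a(1)] e by simp
    then have "\<tau> e = z" using sheeted_inj[OF U(1) \<tau>(1)[OF e(1)]] \<tau>(2)[OF e(1)] z by simp
    then show "z \<in> \<tau> ` base_fibre" using e by blast
  qed
  ultimately have "bij_betw \<tau> base_fibre {e \<in> topspace E. p e = p (\<tau> c)}"
    using \<tau>(2)[OF c_in_base_fibre] by (simp add: bij_betw_def)
  then have "\<tau> \<in> frames"
    using in_sheetD[OF \<tau>(1)[OF c_in_base_fibre]] by (simp add: frames_def \<tau>_def)
  then have "\<tau> \<in> frame_sheet U \<sigma>" using \<tau>(1) by (simp add: frame_sheet_def)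
  then show ?thesis using \<tau>(2)[OF c_in_base_fibre] by blast
qed

lemma bij_betw_frame_sheet:
  assumes \<sigma>: "\<sigma> \<in> frames" and U: "sheeted E X p U" "p (\<sigma> c) \<in> U"
  shows "bij_betw frame_proj (frame_sheet U \<sigma>) U"
  unfolding bij_betw_def
proof
  show "inj_on frame_proj (frame_sheet U \<sigma>)"
  proof (rule inj_onI)
    fix \<tau> \<rho> assume *: "\<tau> \<in> frame_sheet U \<sigma>" "\<rho> \<in> frame_sheet U \<sigma>" "frame_proj \<tau> = frame_proj \<rho>"
    note T = in_frame_sheetD[OF *(1)] and R = in_frame_sheetD[OF *(2)]
    have "\<tau> e = \<rho> e" if e: "e \<in> base_fibre" for e
    proof (rule sheeted_inj[OF U(1) T(4)[OF e] R(4)[OF e]])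
      show "p (\<tau> e) = p (\<rho> e)"
        using frameD(4)[OF T(1) e] frameD(4)[OF R(1) e] *(3) by (simp add: frame_proj_def)
    qed
    then show "\<tau> = \<rho>" using frame_eqI T(1) R(1) by blast
  qed
  show "frame_proj ` frame_sheet U \<sigma> = U"
  proof (intro equalityI subsetI)
    fix y assume "y \<in> frame_proj ` frame_sheet U \<sigma>"
    then show "y \<in> U" using in_frame_sheetD(2) by (auto simp: frame_proj_def)
  next
    fix y assume "y \<in> U"
    then show "y \<in> frame_proj ` frame_sheet U \<sigma>"
      using frame_transport[OF \<sigma> U] by (force simp: frame_proj_def)
  qed
qed

lemma partial_covering_frames: "partial_covering frame_topology X frame_proj"
  unfolding partial_covering_def
proof (intro conjI ballI)
  show "continuous_map frame_topology X frame_proj"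
    unfolding continuous_map_def
  proof (intro conjI allI impI)
    show "frame_proj \<in> topspace frame_topology \<rightarrow> topspace X"
      using frameD(3)[OF _ c_in_base_fibre] partial_coveringD(3)[OF p] by (auto simp: frame_proj_def)
    fix W assume W: "openin X W"
    show "openin frame_topology {\<sigma> \<in> topspace frame_topology. frame_proj \<sigma> \<in> W}"
      unfolding openin_frame_topology
    proof (intro conjI ballI)
      fix \<sigma> assume "\<sigma> \<in> {\<sigma> \<in> topspace frame_topology. frame_proj \<sigma> \<in> W}"
      then obtain U where U: "p (\<sigma> c) \<in> U" "U \<subseteq> W" "sheeted E X p U"
        using sheeted_basis[OF p X W] by (auto simp: frame_proj_def)
      have "frame_sheet U \<sigma> \<subseteq> {\<sigma> \<in> topspace frame_topology. frame_proj \<sigma> \<in> W}"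
        using in_frame_sheetD(1,2) U(2) by (fastforce simp: frame_proj_def)
      then show "\<exists>U. p (\<sigma> c) \<in> U \<and> sheeted E X p U \<and>
          frame_sheet U \<sigma> \<subseteq> {\<sigma> \<in> topspace frame_topology. frame_proj \<sigma> \<in> W}"
        using U by blast
    qed auto
  qed
  show "open_map frame_topology X frame_proj"
    unfolding open_map_def
  proof (intro allI impI)
    fix A assume A: "openin frame_topology A"
    show "openin X (frame_proj ` A)"
    proof (subst openin_subopen, intro ballI)
      fix x assume "x \<in> frame_proj ` A"
      then obtain \<sigma> where \<sigma>: "\<sigma> \<in> A" "x = p (\<sigma> c)" by (auto simp: frame_proj_def)
      then obtain U where U: "p (\<sigma> c) \<in> U" "sheeted E X p U" "frame_sheet U \<sigma> \<subseteq> A"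
        using A unfolding openin_frame_topology by blast
      have "\<sigma> \<in> frames" using A \<sigma> unfolding openin_frame_topology by blast
      then have "U = frame_proj ` frame_sheet U \<sigma>"
        using bij_betw_frame_sheet[of \<sigma> U] U(1,2) by (simp add: bij_betw_def)
      then have "U \<subseteq> frame_proj ` A" using U(3) by blast
      then show "\<exists>T. openin X T \<and> x \<in> T \<and> T \<subseteq> frame_proj ` A"
        using U \<sigma> by (auto simp: sheeted_def)
    qed
  qed
  fix x assume x: "x \<in> topspace X"
  obtain U where U: "x \<in> U" "sheeted E X p U"
    using sheeted_basis[OF p X openin_topspace x] by blast
  let ?\<V> = "frame_sheet U ` {\<sigma> \<in> frames. p (\<sigma> c) \<in> U}"
  have "evenly_covered frame_topology frame_proj U"
    unfolding evenly_covered_def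
  proof (intro exI conjI)
    have "\<tau> \<in> frames \<and> p (\<tau> c) \<in> U" if "\<tau> \<in> frame_sheet U \<sigma>" for \<sigma> \<tau>
      using in_frame_sheetD[OF that] by blast
    then show "\<Union>?\<V> = {\<sigma> \<in> topspace frame_topology. frame_proj \<sigma> \<in> U}"
      using frame_sheet_self by (auto simp: frame_proj_def)
    show "\<forall>V\<in>?\<V>. openin frame_topology V \<and> bij_betw frame_proj V U"
      using openin_frame_sheet[OF U(2)] bij_betw_frame_sheet[OF _ U(2)] by blast
    show "pairwise disjnt ?\<V>"
      unfolding pairwise_def disjnt_iff by (auto dest: frame_sheet_eq)
  qed
  then show "\<exists>U. x \<in> U \<and> openin X U \<and> evenly_covered frame_topology frame_proj U"
    using U by (auto simp: sheeted_def)
qed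

text \<open>Evaluation at a point of the base fibre is the morphism from frames to \<open>E\<close>. A neighbourhood of
  \<open>\<sigma> e\<close> may be smaller than a sheet, so \<open>U\<close> is shrunk to the projection of that neighbourhood.\<close>

lemma continuous_map_frame_eval: "continuous_map frame_topology E (\<lambda>\<sigma>. \<sigma> e)" if e: "e \<in> base_fibre"
  unfolding continuous_map_def
proof (intro conjI allI impI)
  show "(\<lambda>\<sigma>. \<sigma> e) \<in> topspace frame_topology \<rightarrow> topspace E"
    using frameD(3)[OF _ e] by simp
  fix O' assume O': "openin E O'"
  show "openin frame_topology {\<sigma> \<in> topspace frame_topology. \<sigma> e \<in> O'}"
    unfolding openin_frame_topology
  proof (intro conjI ballI)
    fix \<sigma> assume "\<sigma> \<in> {\<sigma> \<in> topspace frame_topology. \<sigma> e \<in> O'}"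
    then have \<sigma>: "\<sigma> \<in> frames" "\<sigma> e \<in> O'" by auto
    obtain U where U: "p (\<sigma> c) \<in> U" "sheeted E X p U" using sheeted_nbhd_frame[OF \<sigma>(1)] by blast
    have \<sigma>e: "\<sigma> e \<in> topspace E" "p (\<sigma> e) = p (\<sigma> c)" using frameD(3,4)[OF \<sigma>(1) e] by auto
    let ?O = "sheet E p U (\<sigma> e) \<inter> O'"
    have "openin E ?O" using U \<sigma>e O' by (auto simp: sheeted_def)
    then have "openin X (p ` ?O)" using partial_coveringD(2)[OF p] by (simp add: open_map_def)
    moreover have "p (\<sigma> c) \<in> p ` ?O"
      using \<sigma>(2) \<sigma>e U(1) by (intro image_eqI[of _ _ "\<sigma> e"]) (auto simp: sheet_self)
    ultimately obtain W where W: "p (\<sigma> c) \<in> W" "W \<subseteq> p ` ?O" "sheeted E X p W"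
      using sheeted_basis[OF p X] by metis
    have "W \<subseteq> U" using W(2) in_sheetD by fast
    have "\<tau> e \<in> O'" if \<tau>: "\<tau> \<in> frame_sheet W \<sigma>" for \<tau>
    proof -
      have 1: "\<tau> e \<in> sheet E p W (\<sigma> e)" using in_frame_sheetD(4)[OF \<tau> e] .
      then have 2: "\<tau> e \<in> sheet E p U (\<sigma> e)" using sheet_mono[OF \<open>W \<subseteq> U\<close>, of E p "\<sigma> e"] by blast
      obtain b where b: "b \<in> ?O" "p (\<tau> e) = p b" using in_sheetD[OF 1] W(2) by blast
      have "\<tau> e = b" using sheeted_inj[OF U(2) 2 _ b(2)] b(1) by blast
      then show ?thesis using b by blast
    qed
    then have "frame_sheet W \<sigma> \<subseteq> {\<sigma> \<in> topspace frame_topology. \<sigma> e \<in> O'}"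
      using in_frame_sheetD(1) by auto
    then show "\<exists>U. p (\<sigma> c) \<in> U \<and> sheeted E X p U \<and>
        frame_sheet U \<sigma> \<subseteq> {\<sigma> \<in> topspace frame_topology. \<sigma> e \<in> O'}"
      using W by blast
  qed auto
qed

lemma frame_reindex:
  assumes \<alpha>: "bij_betw \<alpha> base_fibre base_fibre" and \<sigma>: "\<sigma> \<in> frames"
  shows "compose base_fibre \<sigma> \<alpha> \<in> frames" "frame_proj (compose base_fibre \<sigma> \<alpha>) = frame_proj \<sigma>"
proof -
  have \<alpha>F: "\<alpha> e \<in> base_fibre" if "e \<in> base_fibre" for e using \<alpha> that by (auto simp: bij_betw_def)
  have pc: "p (compose base_fibre \<sigma> \<alpha> c) = p (\<sigma> c)"
    using frameD(4)[OF \<sigma> \<alpha>F[OF c_in_base_fibre]] c_in_base_fibre by (simp add: compose_def)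
  then show "frame_proj (compose base_fibre \<sigma> \<alpha>) = frame_proj \<sigma>" by (simp add: frame_proj_def)
  have "bij_betw (compose base_fibre \<sigma> \<alpha>) base_fibre {e \<in> topspace E. p e = p (\<sigma> c)}"
    using \<alpha> frameD(2)[OF \<sigma>] by (rule bij_betw_compose)
  moreover have "compose base_fibre \<sigma> \<alpha> c \<in> topspace E"
    using frameD(3)[OF \<sigma> \<alpha>F[OF c_in_base_fibre]] c_in_base_fibre by (simp add: compose_def)
  ultimately show "compose base_fibre \<sigma> \<alpha> \<in> frames"
    by (simp add: frames_def pc)
qed

lemma continuous_map_frame_reindex:
  assumes \<alpha>: "bij_betw \<alpha> base_fibre base_fibre"
  shows "continuous_map frame_topology frame_topology (\<lambda>\<sigma>. compose base_fibre \<sigma> \<alpha>)"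
  unfolding continuous_map_def
proof (intro conjI allI impI)
  let ?R = "\<lambda>\<sigma>. compose base_fibre \<sigma> \<alpha>"
  have \<alpha>F: "\<alpha> e \<in> base_fibre" if "e \<in> base_fibre" for e using \<alpha> that by (auto simp: bij_betw_def)
  show "?R \<in> topspace frame_topology \<rightarrow> topspace frame_topology"
    using frame_reindex(1)[OF \<alpha>] by simp
  fix A assume A: "openin frame_topology A"
  show "openin frame_topology {\<sigma> \<in> topspace frame_topology. ?R \<sigma> \<in> A}"
    unfolding openin_frame_topology
  proof (intro conjI ballI)
    fix \<sigma> assume "\<sigma> \<in> {\<sigma> \<in> topspace frame_topology. ?R \<sigma> \<in> A}"
    then have \<sigma>: "\<sigma> \<in> frames" "?R \<sigma> \<in> A" by auto
    then obtain U where U: "p (?R \<sigma> c) \<in> U" "sheeted E X p U" "frame_sheet U (?R \<sigma>) \<subseteq> A"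
      using A unfolding openin_frame_topology by blast
    have "p (\<sigma> c) \<in> U" using U(1) frame_reindex(2)[OF \<alpha> \<sigma>(1)] by (simp add: frame_proj_def)
    moreover have "?R \<tau> \<in> frame_sheet U (?R \<sigma>)" if \<tau>: "\<tau> \<in> frame_sheet U \<sigma>" for \<tau>
      using in_frame_sheetD[OF \<tau>] frame_reindex(1)[OF \<alpha>, of \<tau>] \<alpha>F
      by (simp add: frame_sheet_def compose_def)
    then have "frame_sheet U \<sigma> \<subseteq> {\<sigma> \<in> topspace frame_topology. ?R \<sigma> \<in> A}"
      using U(3) in_frame_sheetD(1) by auto
    ultimately show "\<exists>U. p (\<sigma> c) \<in> U \<and> sheeted E X p U \<and>
        frame_sheet U \<sigma> \<subseteq> {\<sigma> \<in> topspace frame_topology. ?R \<sigma> \<in> A}"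
      using U(2) by blast
  qed auto
qed

end

end

section \<open>Universal covers are regular\<close>

text \<open>Let \<open>D\<close> be the path component of the identity frame. By universality there is a covering
  \<open>h : C \<rightarrow> D\<close>; choose \<open>c\<close> with \<open>h c\<close> the identity frame. Evaluation at \<open>c\<close> composed with \<open>h\<close> is a lift of
  the projection that fixes \<open>c\<close>, so it is the identity, and \<open>C\<close> is isomorphic to \<open>D\<close>. Now \<open>D\<close> is
  regular: precomposition with a frame \<open>\<sigma>\<close> of the base fibre to itself takes the identity frame to \<open>\<sigma>\<close>,
  hence maps \<open>D\<close> to itself if \<open>\<sigma>\<close> lies in \<open>D\<close>. Path-connectedness of \<open>C\<close> comes from the same
  isomorphism.\<close>

lemma universal_cover_regular:
  fixes C :: "('b, 'a) cover" and m :: "'a metric"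
  assumes C: "universal_cover m C" and lpc: "locally_path_connected_space (mtopology_of m)"
    and ne: "topspace (total C) \<noteq> {}"
  obtains c where "c \<in> topspace (total C)" "path_connected_space (total C)"
    "\<forall>e\<in>topspace (total C). proj C e = proj C c \<longrightarrow> (\<exists>g\<in>deck C. g c = e)"
proof -
  define E p X where "E = total C" and "p = proj C" and "X = mtopology_of m"
  have p: "partial_covering E X p" "connected_space E" "p ` topspace E = topspace X"
    using C by (auto simp: universal_cover_def is_cover_def covering_map_iff E_def p_def X_def)
  have X: "locally_path_connected_space X" "connected_space X"
  proof -
    show "locally_path_connected_space X" using lpc by (simp add: X_def)
    have "connectedin X (p ` topspace E)"
      using partial_coveringD(1)[OF p(1)] p(2)
      by (simp add: connectedin_continuous_map_image connectedin_topspace)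
    then show "connected_space X" by (simp add: p(3) connectedin_topspace)
  qed
  obtain c0 where c0: "c0 \<in> topspace E" using ne unfolding E_def by blast
  let ?F = "base_fibre E p c0" and ?S = "frame_topology E X p c0" and ?\<pi> = "frame_proj p c0"
  note ctx = p(1) X(1) c0
  have S: "topspace ?S = frames E p c0" by (rule topspace_frame_topology[OF ctx])
  have c0F: "c0 \<in> ?F" by (rule c_in_base_fibre[OF ctx])
  define I where "I = restrict id ?F"
  have "p (I c0) = p c0" "I c0 = c0" using c0F by (simp_all add: I_def)
  then have I: "I \<in> frames E p c0" "?\<pi> I = p c0"
    using c0 by (auto simp: frames_def frame_proj_def I_def base_fibre_def bij_betw_def inj_on_def)
  define D where "D = path_component_of_set ?S I"
  have ID: "I \<in> D" using I by (simp add: D_def path_component_of_refl S)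
  have DS: "D \<subseteq> frames E p c0" using path_component_of_subset_topspace[of ?S I] by (simp add: D_def S)
  have topD: "topspace (subtopology ?S D) = D" using DS by (auto simp: S)
  have covD: "covering_map (subtopology ?S D) X ?\<pi>"
    unfolding D_def
    by (rule covering_map_path_component[OF partial_covering_frames[OF ctx] X]) (simp add: S I)
  have pcD: "path_connected_space (subtopology ?S D)"
    using path_connectedin_path_component_of[of ?S I] by (simp add: D_def path_connectedin_def)
  have "is_cover m (subtopology ?S D, ?\<pi>)"
    using covD path_connected_imp_connected_space[OF pcD] by (simp add: is_cover_def X_def)
  moreover have "path_connected_space (total (subtopology ?S D, ?\<pi>))" using pcD by simp
  moreover have "topspace (total (subtopology ?S D, ?\<pi>)) \<noteq> {}" unfolding fst_conv topD using ID by blast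
  ultimately obtain Z :: "('a cover_point, 'a) cover" and \<psi> where Z: "is_cover m Z"
      "homeomorphic_map (total Z) (total (subtopology ?S D, ?\<pi>)) \<psi>"
      "\<And>z. z \<in> topspace (total Z) \<Longrightarrow> proj (subtopology ?S D, ?\<pi>) (\<psi> z) = proj Z z"
    by (rule cover_point_realisation) (rule that)
  have \<psi>: "homeomorphic_map (total Z) (subtopology ?S D) \<psi>"
    "\<And>z. z \<in> topspace (total Z) \<Longrightarrow> ?\<pi> (\<psi> z) = proj Z z"
    using Z(2,3) by simp_all
  have "covers C Z" using C Z(1) unfolding universal_cover_def by blast
  then obtain f where f: "covering_map E (total Z) f"
      "\<And>x. x \<in> topspace E \<Longrightarrow> proj Z (f x) = p x"
    unfolding covers_def E_def p_def by blast
  have f_top: "f x \<in> topspace (total Z)" if "x \<in> topspace E" for x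
    using f(1) that by (auto simp: covering_map_def)
  define h where "h = \<psi> \<circ> f"
  have h_cont: "continuous_map E (subtopology ?S D) h"
    unfolding h_def using f(1) homeomorphic_imp_continuous_map[OF \<psi>(1)]
    by (auto simp: covering_map_def intro: continuous_map_compose)
  have h_surj: "h ` topspace E = D"
  proof -
    have "f ` topspace E = topspace (total Z)" using f(1) by (simp add: covering_map_def)
    then show ?thesis
      unfolding h_def image_comp[symmetric]
      using homeomorphic_imp_surjective_map[OF \<psi>(1)] by (simp only: topD)
  qed
  have h_proj: "?\<pi> (h x) = p x" if "x \<in> topspace E" for x
    using f(2)[OF that] \<psi>(2)[OF f_top[OF that]] by (simp add: h_def)
  obtain c where c: "c \<in> topspace E" "h c = I" using h_surj ID by (metis imageE)
  have pc: "p c = p c0" using h_proj[OF c(1)] c(2) I(2) by simp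
  then have cF: "c \<in> ?F" using c(1) by (simp add: base_fibre_def)
  let ?ev = "\<lambda>\<sigma>. \<sigma> c"
  have ev_cont: "continuous_map (subtopology ?S D) E ?ev"
    using continuous_map_frame_eval[OF ctx cF] by (rule continuous_map_from_subtopology)
  have ev_proj: "p (\<sigma> c) = ?\<pi> \<sigma>" if "\<sigma> \<in> D" for \<sigma>
    using frameD(4)[OF ctx _ cF] that DS by (auto simp: frame_proj_def)
  have hD: "h x \<in> D" if "x \<in> topspace E" for x using h_surj that by blast
  have ev_h: "?ev (h x) = x" if x: "x \<in> topspace E" for x
  proof -
    have "continuous_map E E (\<lambda>x. ?ev (h x))"
      using continuous_map_compose[OF h_cont ev_cont] by (simp add: o_def)
    moreover have "continuous_map E E (\<lambda>x. x)" by simp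
    moreover have "p (?ev (h x)) = p x" if "x \<in> topspace E" for x
      using ev_proj[OF hD[OF that]] h_proj[OF that] by simp
    moreover have "?ev (h c) = c" using c(2) cF by (simp add: I_def)
    ultimately show ?thesis
      using lift_unique[OF p(1,2), of "\<lambda>x. ?ev (h x)" "\<lambda>x. x" c x] c(1) x by blast
  qed
  have maps: "homeomorphic_maps E (subtopology ?S D) h ?ev"
    unfolding homeomorphic_maps_def
  proof (intro conjI ballI h_cont ev_cont ev_h)
    fix \<sigma> assume "\<sigma> \<in> topspace (subtopology ?S D)"
    then obtain x where "x \<in> topspace E" "\<sigma> = h x" using h_surj topD by blast
    then show "h (?ev \<sigma>) = \<sigma>" using ev_h by simp
  qed
  have pcE: "path_connected_space E"
  proof -
    have "path_connectedin E (?ev ` topspace (subtopology ?S D))"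
      using ev_cont path_connectedin_topspace[THEN iffD2, OF pcD]
      by (rule path_connectedin_continuous_map_image)
    moreover have "?ev ` topspace (subtopology ?S D) = topspace E"
      using maps homeomorphic_imp_surjective_map homeomorphic_maps_map by metis
    ultimately show ?thesis by (simp add: path_connectedin_topspace)
  qed
  have "\<exists>g\<in>deck C. g c = e" if e: "e \<in> topspace E" "p e = p c" for e
  proof -
    define \<sigma> where "\<sigma> = h e"
    have \<sigma>D: "\<sigma> \<in> D" using hD[OF e(1)] by (simp add: \<sigma>_def)
    then have \<sigma>S: "\<sigma> \<in> frames E p c0" using DS by blast
    have "p (\<sigma> c0) = p c0"
      using h_proj[OF e(1)] e(2) pc by (simp add: \<sigma>_def frame_proj_def)
    then have bij: "bij_betw \<sigma> ?F ?F"
      using frameD(2)[OF ctx \<sigma>S] by (simp add: base_fibre_def)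
    define \<alpha> where "\<alpha> = inv_into ?F \<sigma>"
    have bij': "bij_betw \<alpha> ?F ?F" unfolding \<alpha>_def by (rule bij_betw_inv_into[OF bij])
    have inv: "\<alpha> (\<sigma> x) = x" "\<sigma> (\<alpha> x) = x" "\<sigma> x \<in> ?F" "\<alpha> x \<in> ?F" if "x \<in> ?F" for x
      using that bij bij' unfolding \<alpha>_def
      by (auto simp: bij_betw_inv_into_left bij_betw_inv_into_right bij_betw_apply)
    let ?R = "\<lambda>\<beta> \<tau>. compose ?F \<tau> \<beta>"
    have sub: "?R \<beta> ` D \<subseteq> D" if \<beta>: "bij_betw \<beta> ?F ?F" and \<tau>: "\<tau> \<in> D" "?R \<beta> \<tau> \<in> D" for \<beta> \<tau>
    proof -
      have "path_connectedin ?S (?R \<beta> ` D)"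
        using continuous_map_frame_reindex[OF ctx \<beta>]
        by (rule path_connectedin_continuous_map_image) (simp add: D_def path_connectedin_path_component_of)
      then have "?R \<beta> ` D \<subseteq> path_component_of_set ?S (?R \<beta> \<tau>)"
        by (rule path_component_of_maximal) (use \<tau> in blast)
      also have "\<dots> = D"
        using \<tau>(2) unfolding D_def by (simp add: path_component_of_equiv)
      finally show ?thesis .
    qed
    have RI: "?R \<sigma> I = \<sigma>"
      using frameD(1)[OF ctx \<sigma>S] inv(3)
      by (intro extensionalityI[of _ ?F]) (auto simp: compose_def I_def)
    have R\<sigma>: "?R \<alpha> \<sigma> = I"
      using inv by (intro extensionalityI[of _ ?F]) (auto simp: compose_def I_def)
    have D\<sigma>: "?R \<sigma> ` D \<subseteq> D" using sub[OF bij ID] RI \<sigma>D by simp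
    have D\<alpha>: "?R \<alpha> ` D \<subseteq> D" using sub[OF bij' \<sigma>D] R\<sigma> ID by simp
    have contR: "continuous_map (subtopology ?S D) (subtopology ?S D) (?R \<beta>)"
      if "bij_betw \<beta> ?F ?F" "?R \<beta> ` D \<subseteq> D" for \<beta>
      using continuous_map_frame_reindex[OF ctx that(1)] that(2)
      by (auto simp: continuous_map_in_subtopology topD intro: continuous_map_from_subtopology)
    have "homeomorphic_maps (subtopology ?S D) (subtopology ?S D) (?R \<sigma>) (?R \<alpha>)"
      unfolding homeomorphic_maps_def
    proof (intro conjI ballI contR bij bij' D\<sigma> D\<alpha>)
      fix \<tau> assume "\<tau> \<in> topspace (subtopology ?S D)"
      then have "\<tau> \<in> extensional ?F" using frameD(1)[OF ctx] DS topD by blast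
      then show "?R \<alpha> (?R \<sigma> \<tau>) = \<tau>" "?R \<sigma> (?R \<alpha> \<tau>) = \<tau>"
        using inv by (auto intro!: extensionalityI[of _ ?F] simp: compose_def)
    qed
    then have "homeomorphic_map (subtopology ?S D) (subtopology ?S D) (?R \<sigma>)"
      by (simp add: homeomorphic_maps_map)
    moreover have "homeomorphic_map E (subtopology ?S D) h" "homeomorphic_map (subtopology ?S D) E ?ev"
      using maps by (simp_all add: homeomorphic_maps_map)
    ultimately have "homeomorphic_map E E (?ev \<circ> (?R \<sigma> \<circ> h))"
      by (intro homeomorphic_map_compose)
    moreover have "p ((?ev \<circ> (?R \<sigma> \<circ> h)) x) = p x" if x: "x \<in> topspace E" for x
    proof -
      have "?R \<sigma> (h x) \<in> D" using D\<sigma> hD[OF x] by blast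
      then have "p ((?ev \<circ> (?R \<sigma> \<circ> h)) x) = ?\<pi> (?R \<sigma> (h x))" using ev_proj by simp
      also have "\<dots> = ?\<pi> (h x)" using frame_reindex(2)[OF ctx bij] hD[OF x] DS by blast
      finally show ?thesis using h_proj[OF x] by simp
    qed
    ultimately have "restrict (?ev \<circ> (?R \<sigma> \<circ> h)) (topspace E) \<in> deck C"
      using deckI[of C "?ev \<circ> (?R \<sigma> \<circ> h)"] by (simp add: E_def p_def)
    moreover have "restrict (?ev \<circ> (?R \<sigma> \<circ> h)) (topspace E) c = e"
      using c RI ev_h[OF e(1)] by (simp add: \<sigma>_def)
    ultimately show ?thesis by blast
  qed
  then show ?thesis
    using that[of c] c(1) pcE by (simp add: E_def p_def)
qed

section \<open>The groups generated by short deck transformations, and the covering spectrum\<close>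

text \<open>A curve and its translate have the same projection, on which length is measured.\<close>

lemma lifted_dist_deck_le:
  assumes g: "g \<in> deck C"
  shows "lifted_dist m C (g x) (g y) \<le> lifted_dist m C x y"
  unfolding lifted_dist_def
proof (rule INF_mono)
  fix \<gamma> assume "\<gamma> \<in> {\<gamma>. pathin (total C) \<gamma> \<and> \<gamma> 0 = x \<and> \<gamma> 1 = y}"
  then have \<gamma>: "pathin (total C) \<gamma>" "\<gamma> 0 = x" "\<gamma> 1 = y" by auto
  have proj_eq: "proj C (g (\<gamma> t)) = proj C (\<gamma> t)" if "t \<in> {0..1}" for t
    using deckD(6)[OF g] path_image_subset_topspace[OF \<gamma>(1)] that by blast
  have "curve_length m (proj C \<circ> (g \<circ> \<gamma>)) \<le> curve_length m (proj C \<circ> \<gamma>)"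
    unfolding curve_length_def
  proof (rule SUP_mono)
    fix ts :: "real list" assume ts: "ts \<in> {ts. sorted ts \<and> set ts \<subseteq> {0..1}}"
    have "(\<Sum>i<length ts - 1. mdist m ((proj C \<circ> (g \<circ> \<gamma>)) (ts ! i)) ((proj C \<circ> (g \<circ> \<gamma>)) (ts ! Suc i))) =
        (\<Sum>i<length ts - 1. mdist m ((proj C \<circ> \<gamma>) (ts ! i)) ((proj C \<circ> \<gamma>) (ts ! Suc i)))"
    proof (rule sum.cong[OF refl])
      fix i assume "i \<in> {..<length ts - 1}"
      then have "ts ! i \<in> {0..1}" "ts ! Suc i \<in> {0..1}"
        using ts by (auto dest!: subsetD[where c = "ts ! _"])
      then show "mdist m ((proj C \<circ> (g \<circ> \<gamma>)) (ts ! i)) ((proj C \<circ> (g \<circ> \<gamma>)) (ts ! Suc i)) =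
          mdist m ((proj C \<circ> \<gamma>) (ts ! i)) ((proj C \<circ> \<gamma>) (ts ! Suc i))"
        by (simp add: proj_eq)
    qed
    then show "\<exists>ts'\<in>{ts. sorted ts \<and> set ts \<subseteq> {0..1}}.
        ennreal (\<Sum>i<length ts - 1. mdist m ((proj C \<circ> (g \<circ> \<gamma>)) (ts ! i)) ((proj C \<circ> (g \<circ> \<gamma>)) (ts ! Suc i)))
        \<le> ennreal (\<Sum>i<length ts' - 1. mdist m ((proj C \<circ> \<gamma>) (ts' ! i)) ((proj C \<circ> \<gamma>) (ts' ! Suc i)))"
      using ts by (intro bexI[of _ ts]) simp_all
  qed
  moreover have "pathin (total C) (g \<circ> \<gamma>)" using \<gamma>(1) deckD(2)[OF g] by (rule pathin_compose)
  ultimately show "\<exists>\<gamma>'\<in>{\<gamma>. pathin (total C) \<gamma> \<and> \<gamma> 0 = g x \<and> \<gamma> 1 = g y}.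
      curve_length m (proj C \<circ> \<gamma>') \<le> curve_length m (proj C \<circ> \<gamma>)"
    using \<gamma> by (intro bexI[of _ "g \<circ> \<gamma>"]) auto
qed

lemma deck_length_conj_le:
  assumes g: "g \<in> deck C" and h: "h \<in> deck C"
  shows "deck_length m C (g \<otimes>\<^bsub>deck_group C\<^esub> h \<otimes>\<^bsub>deck_group C\<^esub> inv\<^bsub>deck_group C\<^esub> g) \<le> deck_length m C h"
  unfolding deck_length_def
proof (rule INF_mono)
  interpret group "deck_group C" by (rule group_deck_group)
  fix x assume x: "x \<in> topspace (total C)"
  let ?k = "g \<otimes>\<^bsub>deck_group C\<^esub> h \<otimes>\<^bsub>deck_group C\<^esub> inv\<^bsub>deck_group C\<^esub> g"
  have i: "inv\<^bsub>deck_group C\<^esub> g \<in> deck C" and gh: "g \<otimes>\<^bsub>deck_group C\<^esub> h \<in> deck C"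
    using g h inv_closed[of g] m_closed[of g h] by simp_all
  have gx: "g x \<in> topspace (total C)" using deckD(5)[OF g x] .
  have "?k (g x) = g (h x)"
    using deck_group_mult_apply[OF gh i gx] deck_group_inv_apply(1)[OF g x]
      deck_group_mult_apply[OF g h x] by simp
  then show "\<exists>y\<in>topspace (total C). lifted_dist m C (?k y) y \<le> lifted_dist m C (h x) x"
    using lifted_dist_deck_le[OF g, of m "h x" x] gx by (intro bexI[of _ "g x"]) simp_all
qed

lemma pi1_delta_normal: "pi1_delta m C \<delta> \<lhd> deck_group C"
proof -
  interpret group "deck_group C" by (rule group_deck_group)
  show ?thesis
    unfolding pi1_delta_def
  proof (rule normal_generateI)
    fix h g assume h: "h \<in> {g \<in> deck C. deck_length m C g < ennreal (2 * \<delta>)}"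
      and g: "g \<in> carrier (deck_group C)"
    then have "g \<otimes>\<^bsub>deck_group C\<^esub> h \<otimes>\<^bsub>deck_group C\<^esub> inv\<^bsub>deck_group C\<^esub> g \<in> deck C"
      using m_closed[of "g \<otimes>\<^bsub>deck_group C\<^esub> h" "inv\<^bsub>deck_group C\<^esub> g"] m_closed[of g h] inv_closed[of g] by simp
    then show "g \<otimes>\<^bsub>deck_group C\<^esub> h \<otimes>\<^bsub>deck_group C\<^esub> inv\<^bsub>deck_group C\<^esub> g
        \<in> {g \<in> deck C. deck_length m C g < ennreal (2 * \<delta>)}"
      using deck_length_conj_le[of g C h m] g h by (auto intro: le_less_trans)
  qed auto
qed

lemma pi1_delta_subgroup: "subgroup (pi1_delta m C \<delta>) (deck_group C)"
  using pi1_delta_normal by (rule normal_imp_subgroup)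

lemma pi1_delta_mono: "\<delta> \<le> \<epsilon> \<Longrightarrow> pi1_delta m C \<delta> \<subseteq> pi1_delta m C \<epsilon>"
  unfolding pi1_delta_def
proof (rule group.mono_generate[OF group_deck_group], clarify)
  fix g assume "\<delta> \<le> \<epsilon>" "deck_length m C g < ennreal (2 * \<delta>)"
  moreover have "ennreal (2 * \<delta>) \<le> ennreal (2 * \<epsilon>)" using \<open>\<delta> \<le> \<epsilon>\<close> by (simp add: ennreal_leI)
  ultimately show "deck_length m C g < ennreal (2 * \<epsilon>)" using less_le_trans by blast
qed

text \<open>Left continuity of the family of groups: a generator \<open>g\<close> satisfies the strict inequality
  \<open>L g < 2\<delta>\<close>, hence already \<open>L g < 2\<epsilon>\<close> for all \<open>\<epsilon>\<close> sufficiently close to \<open>\<delta>\<close>.\<close>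

lemma pi1_delta_subset_if_approached:
  assumes "\<And>\<epsilon>. \<epsilon> < \<delta> \<Longrightarrow> \<exists>\<epsilon>'>\<epsilon>. pi1_delta m C \<epsilon>' \<subseteq> H"
    and H: "subgroup H (deck_group C)" and "\<delta> > 0"
  shows "pi1_delta m C \<delta> \<subseteq> H"
proof -
  have "g \<in> H" if g: "g \<in> deck C" "deck_length m C g < ennreal (2 * \<delta>)" for g
  proof -
    obtain r where r: "deck_length m C g = ennreal r" "r \<ge> 0"
      using g(2) by (cases "deck_length m C g") auto
    then have "r / 2 < \<delta>" using g(2) \<open>\<delta> > 0\<close> by (simp add: ennreal_less_iff)
    then obtain \<epsilon> where \<epsilon>: "r / 2 < \<epsilon>" "pi1_delta m C \<epsilon> \<subseteq> H" using assms(1) by blast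
    then have "deck_length m C g < ennreal (2 * \<epsilon>)" using r by (simp add: ennreal_less_iff)
    then have "g \<in> pi1_delta m C \<epsilon>" using g(1) by (simp add: pi1_delta_def generate.incl)
    then show ?thesis using \<epsilon> by blast
  qed
  then show ?thesis
    unfolding pi1_delta_def
    by (intro group.generate_subgroup_incl[OF group_deck_group _ H]) blast
qed

context
  fixes m :: "'a metric" and C :: "('b, 'a) cover" and c :: 'b
  assumes C: "is_cover m C" and X: "locally_path_connected_space (mtopology_of m)"
    and c: "c \<in> topspace (total C)"
    and regular: "\<forall>e\<in>topspace (total C). proj C e = proj C c \<longrightarrow> (\<exists>g\<in>deck C. g c = e)"
begin

text \<open>Regularity provides a deck transformation \<open>g\<close> that realises the morphism at one point, and
  unique lifting extends the equality from that point to \<open>C\<close>.\<close>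

lemma quotient_cover_morphism_is_translation:
  assumes H: "subgroup H (deck_group C)" and K: "subgroup K (deck_group C)"
    and f: "continuous_map (total (quotient_cover C H)) (total (quotient_cover C K)) f"
    and f_proj: "\<And>x. x \<in> topspace (total (quotient_cover C H)) \<Longrightarrow>
      proj (quotient_cover C K) (f x) = proj (quotient_cover C H) x"
  obtains g where "g \<in> deck C"
    "\<And>z. z \<in> topspace (total C) \<Longrightarrow> f (deck_orbit C H z) = deck_orbit C K (g z)"
proof -
  let ?E = "total C" and ?qH = "deck_orbit C H" and ?qK = "deck_orbit C K"
  have tH: "topspace (total (quotient_cover C H)) = ?qH ` topspace ?E"
    and tK: "topspace (total (quotient_cover C K)) = ?qK ` topspace ?E"
    using total_quotient_cover[OF H] total_quotient_cover[OF K] by simp_all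
  have "f (?qH c) \<in> ?qK ` topspace ?E"
    using f c unfolding continuous_map_def tH tK by blast
  then obtain e where e: "e \<in> topspace ?E" "f (?qH c) = ?qK e" by blast
  have "proj C e = proj (quotient_cover C K) (f (?qH c))"
    using proj_quotient_cover[OF K e(1)] e(2) by simp
  also have "\<dots> = proj C c"
    using f_proj[of "?qH c"] c proj_quotient_cover[OF H c] by (simp add: tH)
  finally obtain g where g: "g \<in> deck C" "g c = e" using regular e(1) by blast
  have covK: "partial_covering (total (quotient_cover C K)) (mtopology_of m) (proj (quotient_cover C K))"
    using is_cover_quotient_cover[OF K C X] by (simp add: is_cover_def covering_map_iff)
  have "f (?qH z) = ?qK (g z)" if z: "z \<in> topspace ?E" for z
  proof -
    have conn: "connected_space ?E" using C by (simp add: is_cover_def)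
    have "continuous_map ?E (total (quotient_cover C K)) (\<lambda>z. f (?qH z))"
      using continuous_map_compose[OF continuous_map_deck_orbit[OF H] f] by (simp add: o_def)
    moreover have "continuous_map ?E (total (quotient_cover C K)) (\<lambda>z. ?qK (g z))"
      using continuous_map_compose[OF deckD(2)[OF g(1)] continuous_map_deck_orbit[OF K]] by (simp add: o_def)
    moreover have "proj (quotient_cover C K) (f (?qH z)) = proj (quotient_cover C K) (?qK (g z))"
      if z: "z \<in> topspace ?E" for z
      using f_proj[of "?qH z"] z proj_quotient_cover[OF H z] deckD(6)[OF g(1) z]
        proj_quotient_cover[OF K deckD(5)[OF g(1) z]] by (simp add: tH)
    moreover have "f (?qH c) = ?qK (g c)" using e g by simp
    ultimately show ?thesis
      using lift_unique[OF covK conn, of "\<lambda>z. f (?qH z)" "\<lambda>z. ?qK (g z)" c z] c z by blast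
  qed
  then show ?thesis using that[OF g(1)] by blast
qed

lemma normal_conj_apply:
  assumes K: "K \<lhd> deck_group C" and g: "g \<in> deck C" and k: "k \<in> K"
  shows "\<exists>l\<in>K. \<forall>z\<in>topspace (total C). l (g z) = g (k z)"
    and "\<exists>l\<in>K. \<forall>z\<in>topspace (total C). g (l z) = k (g z)"
proof -
  interpret normal K "deck_group C" by (rule K)
  have kd: "k \<in> deck C" using subset k by auto
  note i = inv_closed[unfolded carrier_deck_group]
  show "\<exists>l\<in>K. \<forall>z\<in>topspace (total C). l (g z) = g (k z)"
  proof (intro bexI ballI)
    let ?l = "g \<otimes>\<^bsub>deck_group C\<^esub> k \<otimes>\<^bsub>deck_group C\<^esub> inv\<^bsub>deck_group C\<^esub> g"
    show "?l \<in> K" using inv_op_closed2 g k by simp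
    fix z assume z: "z \<in> topspace (total C)"
    have "g \<otimes>\<^bsub>deck_group C\<^esub> k \<in> deck C" using m_closed[of g k] g kd by simp
    then show "?l (g z) = g (k z)"
      using deck_group_mult_apply[OF _ i[OF g] deckD(5)[OF g z]] deck_group_inv_apply(1)[OF g z]
        deck_group_mult_apply[OF g kd z] by simp
  qed
  show "\<exists>l\<in>K. \<forall>z\<in>topspace (total C). g (l z) = k (g z)"
  proof (intro bexI ballI)
    let ?l = "inv\<^bsub>deck_group C\<^esub> g \<otimes>\<^bsub>deck_group C\<^esub> k \<otimes>\<^bsub>deck_group C\<^esub> g"
    show "?l \<in> K" using inv_op_closed1 g k by simp
    fix z assume z: "z \<in> topspace (total C)"
    have ik: "inv\<^bsub>deck_group C\<^esub> g \<otimes>\<^bsub>deck_group C\<^esub> k \<in> deck C" using m_closed[of "inv\<^bsub>deck_group C\<^esub> g" k] i[OF g] kd by simp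
    have "?l z = (inv\<^bsub>deck_group C\<^esub> g) (k (g z))"
      using deck_group_mult_apply[OF ik g z] deck_group_mult_apply[OF i[OF g] kd deckD(5)[OF g z]] by simp
    then show "g (?l z) = k (g z)"
      using deck_group_inv_apply(2)[OF g deckD(5)[OF kd deckD(5)[OF g z]]] by simp
  qed
qed

lemma deck_eqI:
  assumes "g \<in> deck C" "h \<in> deck C" "z \<in> topspace (total C)" "g z = h z"
  shows "g = h"
proof -
  have p: "partial_covering (total C) (mtopology_of m) (proj C)" "connected_space (total C)"
    using C by (auto simp: is_cover_def covering_map_iff)
  have "g x = h x" if "x \<in> topspace (total C)" for x
    using lift_unique[OF p, of g h z x] deckD(2)[OF assms(1)] deckD(2)[OF assms(2)]
      deckD(6)[OF assms(1)] deckD(6)[OF assms(2)] assms(3,4) that by simp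
  then show ?thesis
    using deckD(4)[OF assms(1)] deckD(4)[OF assms(2)] unfolding Bij_def
    by (intro extensionalityI[of _ "topspace (total C)"]) auto
qed

text \<open>An isomorphism has the form \<open>Hz \<mapsto> K(g z)\<close>. By normality of \<open>K\<close> it identifies \<open>Hz\<close> and \<open>H(k z)\<close> for all
  \<open>k \<in> K\<close>, so injectivity gives \<open>k z \<in> Hz\<close>, and since deck transformations are determined by one value,
  \<open>k \<in> H\<close>.\<close>

lemma same_quotient_cover_imp_eq:
  assumes H: "subgroup H (deck_group C)" and K: "K \<lhd> deck_group C" and HK: "H \<subseteq> K"
    and same: "same_cover (quotient_cover C H) (quotient_cover C K)"
  shows "H = K"
proof
  have K': "subgroup K (deck_group C)" using K by (rule normal_imp_subgroup)
  obtain f where f: "homeomorphic_map (total (quotient_cover C H)) (total (quotient_cover C K)) f"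
    "\<forall>x\<in>topspace (total (quotient_cover C H)). proj (quotient_cover C K) (f x) = proj (quotient_cover C H) x"
    using same by (auto simp: same_cover_def)
  obtain g where g: "g \<in> deck C"
      "\<And>z. z \<in> topspace (total C) \<Longrightarrow> f (deck_orbit C H z) = deck_orbit C K (g z)"
    using quotient_cover_morphism_is_translation[OF H K' homeomorphic_imp_continuous_map[OF f(1)]] f(2)
    by blast
  show "K \<subseteq> H"
  proof
    fix k assume k: "k \<in> K"
    have kd: "k \<in> deck C" using subgroup_deckD(1)[OF K' k] .
    have kc: "k c \<in> topspace (total C)" using deckD(5)[OF kd c] .
    obtain l where l: "l \<in> K" "l (g c) = g (k c)" using normal_conj_apply(1)[OF K g(1) k] c by blast
    have "deck_orbit C K (g c) = deck_orbit C K (g (k c))"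
      using deck_orbit_eq_iff[OF K' deckD(5)[OF g(1) c] deckD(5)[OF g(1) kc]] l by metis
    then have "f (deck_orbit C H c) = f (deck_orbit C H (k c))" using g(2) c kc by simp
    moreover have "inj_on f (topspace (total (quotient_cover C H)))"
      using f(1) by (rule homeomorphic_imp_injective_map)
    moreover have "deck_orbit C H z \<in> topspace (total (quotient_cover C H))" if "z \<in> topspace (total C)" for z
      using total_quotient_cover[OF H] that by simp
    ultimately have "deck_orbit C H c = deck_orbit C H (k c)" using c kc by (meson inj_onD)
    then obtain h where h: "h \<in> H" "k c = h c" using deck_orbit_eq_iff[OF H c kc] by blast
    then have "k = h" using deck_eqI[OF kd subgroup_deckD(1)[OF H h(1)] c] by simp
    then show "k \<in> H" using h by simp
  qed
qed (rule HK)

text \<open>An endomorphism has the form \<open>Hz \<mapsto> H(g z)\<close>, and \<open>H(g z) = H(g w)\<close> forces \<open>Hz = Hw\<close> for normal \<open>H\<close>.\<close>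

lemma quotient_cover_endomorphism_inj:
  assumes H: "H \<lhd> deck_group C"
    and f: "continuous_map (total (quotient_cover C H)) (total (quotient_cover C H)) f"
    and f_proj: "\<And>x. x \<in> topspace (total (quotient_cover C H)) \<Longrightarrow>
      proj (quotient_cover C H) (f x) = proj (quotient_cover C H) x"
  shows "inj_on f (topspace (total (quotient_cover C H)))"
proof (rule inj_onI)
  have H': "subgroup H (deck_group C)" using H by (rule normal_imp_subgroup)
  obtain g where g: "g \<in> deck C"
      "\<And>z. z \<in> topspace (total C) \<Longrightarrow> f (deck_orbit C H z) = deck_orbit C H (g z)"
    using quotient_cover_morphism_is_translation[OF H' H' f] f_proj by blast
  fix x y assume xy: "x \<in> topspace (total (quotient_cover C H))"
    "y \<in> topspace (total (quotient_cover C H))" "f x = f y"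
  obtain z where z: "z \<in> topspace (total C)" "x = deck_orbit C H z"
    using xy(1) total_quotient_cover[OF H'] by auto
  obtain w where w: "w \<in> topspace (total C)" "y = deck_orbit C H w"
    using xy(2) total_quotient_cover[OF H'] by auto
  have gz: "g z \<in> topspace (total C)" "g w \<in> topspace (total C)"
    using deckD(5)[OF g(1)] z w by auto
  have "deck_orbit C H (g z) = deck_orbit C H (g w)" using xy(3) z w g(2) by simp
  then obtain h where h: "h \<in> H" "g w = h (g z)" using deck_orbit_eq_iff[OF H' gz] by blast
  obtain l where l: "l \<in> H" "g (l z) = h (g z)" using normal_conj_apply(2)[OF H g(1) h(1)] z by blast
  have "l z \<in> topspace (total C)" using deckD(5)[OF subgroup_deckD(1)[OF H' l(1)] z(1)] .
  then have "w = l z"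
    using deckD(3)[OF g(1)] w(1) h l by (auto simp: bij_betw_def inj_on_def)
  then show "x = y" using deck_orbit_eq_iff[OF H' z(1) w(1)] l z w by blast
qed

lemma CovSpec_iff:
  "\<delta> \<in> CovSpec m C \<longleftrightarrow> \<delta> > 0 \<and> (\<forall>\<epsilon>>\<delta>. pi1_delta m C \<delta> \<noteq> pi1_delta m C \<epsilon>)"
proof -
  have "same_cover (delta_cover m C \<delta>) (delta_cover m C \<epsilon>) \<longleftrightarrow> pi1_delta m C \<delta> = pi1_delta m C \<epsilon>"
    if "\<epsilon> > \<delta>" for \<epsilon>
  proof
    assume "same_cover (delta_cover m C \<delta>) (delta_cover m C \<epsilon>)"
    then show "pi1_delta m C \<delta> = pi1_delta m C \<epsilon>"
      using same_quotient_cover_imp_eq[OF pi1_delta_subgroup pi1_delta_normal pi1_delta_mono] that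
      by (simp add: delta_cover_def)
  next
    assume "pi1_delta m C \<delta> = pi1_delta m C \<epsilon>"
    then have "delta_cover m C \<delta> = delta_cover m C \<epsilon>" by (simp add: delta_cover_def)
    moreover have "same_cover D D" for D :: "('b set, 'a) cover"
      unfolding same_cover_def by (intro exI[of _ id]) simp
    ultimately show "same_cover (delta_cover m C \<delta>) (delta_cover m C \<epsilon>)" by simp
  qed
  then show ?thesis by (auto simp: CovSpec_def)
qed

text \<open>If \<open>s = inf CovSpec\<close> were not in the spectrum, the groups would be constant on some interval
  \<open>[s, \<epsilon>]\<close> with \<open>\<epsilon> > s\<close>; but such an interval contains an element \<open>t < \<epsilon>\<close> of the spectrum.\<close>

lemma Inf_CovSpec_in_CovSpec:
  assumes ne: "CovSpec m C \<noteq> {}" and pos: "Inf (CovSpec m C) > 0"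
  shows "Inf (CovSpec m C) \<in> CovSpec m C"
proof (rule ccontr)
  define s where "s = Inf (CovSpec m C)"
  have bdd: "bdd_below (CovSpec m C)"
    using CovSpec_iff by (intro bdd_belowI[of _ 0]) (simp add: less_imp_le)
  assume "Inf (CovSpec m C) \<notin> CovSpec m C"
  then have s: "s \<notin> CovSpec m C" by (simp add: s_def)
  then obtain \<epsilon> where \<epsilon>: "\<epsilon> > s" "pi1_delta m C s = pi1_delta m C \<epsilon>"
    using pos CovSpec_iff[of s] by (auto simp: s_def)
  obtain t where t: "t \<in> CovSpec m C" "t < \<epsilon>"
    using cInf_lessD[OF ne] \<epsilon>(1) unfolding s_def by blast
  have "s \<le> t" unfolding s_def using t(1) bdd by (rule cInf_lower)
  then have "pi1_delta m C t = pi1_delta m C \<epsilon>"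
    using pi1_delta_mono[of s t m C] pi1_delta_mono[of t \<epsilon> m C] \<epsilon>(2) t(2) by auto
  then show False using t CovSpec_iff[of t] by blast
qed

text \<open>No \<open>\<epsilon>\<close> below \<open>s = inf CovSpec\<close> is in the spectrum, so the group does not change immediately to
  the right of \<open>\<epsilon>\<close>; by left continuity it does not change at the end of an interval of constancy
  either. So the maximal interval of constancy from \<open>\<delta>\<close> within \<open>[\<delta>, s]\<close> reaches \<open>s\<close>.\<close>

lemma pi1_delta_constant_below_Inf_CovSpec:
  assumes "0 < \<delta>" "\<delta> \<le> Inf (CovSpec m C)"
  shows "pi1_delta m C \<delta> = pi1_delta m C (Inf (CovSpec m C))"
proof -
  define s where "s = Inf (CovSpec m C)"
  define P where "P = {\<epsilon>. \<delta> \<le> \<epsilon> \<and> \<epsilon> \<le> s \<and> pi1_delta m C \<epsilon> = pi1_delta m C \<delta>}"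
  define t where "t = Sup P"
  have bdd_CS: "bdd_below (CovSpec m C)"
    using CovSpec_iff by (intro bdd_belowI[of _ 0]) (simp add: less_imp_le)
  have \<delta>P: "\<delta> \<in> P" and bdd: "bdd_above P"
    using assms by (auto simp: P_def s_def intro: bdd_aboveI[of _ "Inf (CovSpec m C)"])
  have t: "\<delta> \<le> t" "t \<le> s"
    unfolding t_def using \<delta>P bdd by (auto intro: cSup_upper cSup_least simp: P_def)
  have "pi1_delta m C t \<subseteq> pi1_delta m C \<delta>"
  proof (rule pi1_delta_subset_if_approached)
    fix \<epsilon> assume "\<epsilon> < t"
    then obtain \<epsilon>' where "\<epsilon>' \<in> P" "\<epsilon>' > \<epsilon>"
      unfolding t_def using less_cSupD[of P \<epsilon>] \<delta>P by blast
    then show "\<exists>\<epsilon>'>\<epsilon>. pi1_delta m C \<epsilon>' \<subseteq> pi1_delta m C \<delta>" by (auto simp: P_def)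
  next
    show "subgroup (pi1_delta m C \<delta>) (deck_group C)" by (rule pi1_delta_subgroup)
    show "t > 0" using t assms by simp
  qed
  then have eq: "pi1_delta m C t = pi1_delta m C \<delta>"
    using pi1_delta_mono[OF t(1)] by blast
  have "t = s"
  proof (rule ccontr)
    assume "t \<noteq> s"
    then have ts: "t < s" using t by simp
    then have "t \<notin> CovSpec m C" using cInf_lower[OF _ bdd_CS, of t] by (auto simp: s_def)
    then obtain \<epsilon> where \<epsilon>: "\<epsilon> > t" "pi1_delta m C t = pi1_delta m C \<epsilon>"
      using CovSpec_iff[of t] t assms by auto
    have less: "t < min \<epsilon> s" using \<epsilon> ts by simp
    have "pi1_delta m C (min \<epsilon> s) = pi1_delta m C t"
      using pi1_delta_mono[of t "min \<epsilon> s" m C] pi1_delta_mono[of "min \<epsilon> s" \<epsilon> m C] \<epsilon> ts by auto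
    then have "min \<epsilon> s \<in> P" using eq t ts \<epsilon> by (auto simp: P_def)
    then have "min \<epsilon> s \<le> t" unfolding t_def using bdd by (rule cSup_upper)
    with less show False by (meson leD)
  qed
  then show ?thesis using eq by (simp add: s_def)
qed

end

lemma homeomorphic_map_sym:
  assumes "homeomorphic_map S T f"
  obtains g where "homeomorphic_map T S g" "\<And>x. x \<in> topspace T \<Longrightarrow> f (g x) = x"
    "\<And>x. x \<in> topspace S \<Longrightarrow> g (f x) = x"
proof -
  obtain g where "homeomorphic_maps S T f g"
    using assms by (auto simp: homeomorphic_map_maps)
  then show thesis
    using that[of g] homeomorphic_maps_map[of S T f g] homeomorphic_maps_sym[of S T f g]
    by (simp add: homeomorphic_maps_def)
qed

theorem proposition4p7:
  fixes X :: "'a metric" and C :: "('b, 'a) cover"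
  assumes "complete_length_space X"
    and "\<not> compact_space (mtopology_of X)"
    and "universal_cover X C"
    and "CovSpec X C \<noteq> {}"
    and "Inf (CovSpec X C) > 0"
  shows "(\<exists>\<delta>>0. universal_delta_cover X C (delta_cover X C \<delta>) \<and>
            (\<forall>Y :: ('c, 'a) cover. universal_delta_cover X C Y \<longrightarrow>
               same_cover Y (delta_cover X C \<delta>))) \<and>
         Inf (CovSpec X C) \<in> CovSpec X C"
proof -
  have lpc: "locally_path_connected_space (mtopology_of X)"
    by (rule locally_path_connected_space_length_space[OF assms(1)])
  have C: "is_cover X C" using assms(3) by (simp add: universal_cover_def)
  have "topspace (mtopology_of X) \<noteq> {}"
    using assms(2) compact_space_trivial_topology null_topspace_iff_trivial by metis
  moreover have "proj C ` topspace (total C) = topspace (mtopology_of X)"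
    using C by (simp add: is_cover_def covering_map_def)
  ultimately have "topspace (total C) \<noteq> {}" by blast
  then obtain c where c: "c \<in> topspace (total C)" "path_connected_space (total C)"
      "\<forall>e\<in>topspace (total C). proj C e = proj C c \<longrightarrow> (\<exists>g\<in>deck C. g c = e)"
    by (rule universal_cover_regular[OF assms(3) lpc]) (rule that)
  note ctx = C lpc c(1) c(3)
  define s where "s = Inf (CovSpec X C)"
  define H where "H = pi1_delta X C s"
  define Q where "Q = quotient_cover C H"
  have Q: "delta_cover X C s = Q" by (simp add: delta_cover_def Q_def H_def)
  have H: "subgroup H (deck_group C)" "H \<lhd> deck_group C"
    by (simp_all add: H_def pi1_delta_subgroup pi1_delta_normal)
  have covQ: "is_cover X Q" unfolding Q_def by (rule is_cover_quotient_cover[OF H(1) C lpc])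
  have topQ: "topspace (total Q) = deck_orbit C H ` topspace (total C)"
    by (simp add: Q_def total_quotient_cover[OF H(1)])
  have covers: "covers Q (delta_cover X C \<delta>)" if "\<delta> > 0" for \<delta>
  proof -
    have "H \<subseteq> pi1_delta X C \<delta>"
    proof (cases "\<delta> \<le> s")
      case True
      then have "pi1_delta X C \<delta> = H"
        unfolding H_def s_def by (rule pi1_delta_constant_below_Inf_CovSpec[OF ctx that])
      then show ?thesis by simp
    next
      case False
      then show ?thesis unfolding H_def by (intro pi1_delta_mono) simp
    qed
    then show ?thesis
      unfolding Q_def delta_cover_def
      by (rule covers_quotient_covers[OF C lpc H(1) pi1_delta_subgroup])
  qed
  have s: "s > 0" using assms(5) by (simp add: s_def)
  have univ: "universal_delta_cover X C Q"
    unfolding universal_delta_cover_def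
  proof (intro conjI allI impI covQ covers)
    fix Z :: "('a cover_point, 'a) cover"
    assume "is_cover X Z \<and> (\<forall>\<delta>>0. covers Z (delta_cover X C \<delta>))"
    then show "covers Z Q" using s unfolding Q[symmetric] by blast
  qed
  have uniq: "same_cover Y Q" if Y: "universal_delta_cover X C Y" for Y :: "('c, 'a) cover"
  proof -
    \<comment> \<open>\<open>Q \<rightarrow> Y \<rightarrow> Q\<close> will be injective, where the first map comes from the universal property of \<open>Y\<close>
      applied to a copy of \<open>Q\<close> in the point type it quantifies over\<close>
    have "covers Y Q" using Y s unfolding universal_delta_cover_def Q[symmetric] by blast
    then obtain b where b: "covering_map (total Y) (total Q) b"
        "\<forall>y\<in>topspace (total Y). proj Q (b y) = proj Y y"
      unfolding covers_def by blast
    have "path_connectedin (total Q) (deck_orbit C H ` topspace (total C))"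
      using continuous_map_deck_orbit[OF H(1)] c(2) unfolding Q_def
      by (rule path_connectedin_continuous_map_image[OF _ path_connectedin_topspace[THEN iffD2]])
    then have "path_connected_space (total Q)" by (simp add: path_connectedin_topspace flip: topQ)
    moreover have "topspace (total Q) \<noteq> {}" using c(1) unfolding topQ by blast
    ultimately obtain Z :: "('a cover_point, 'a) cover" and \<psi> where Z: "is_cover X Z"
        "homeomorphic_map (total Z) (total Q) \<psi>"
        "\<And>z. z \<in> topspace (total Z) \<Longrightarrow> proj Q (\<psi> z) = proj Z z"
      by (rule cover_point_realisation[OF covQ]) (rule that)
    have "covers Z (delta_cover X C \<delta>)" if \<delta>: "\<delta> > 0" for \<delta>
    proof -
      obtain f where f: "covering_map (total Q) (total (delta_cover X C \<delta>)) f"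
          "\<forall>x\<in>topspace (total Q). proj (delta_cover X C \<delta>) (f x) = proj Q x"
        using covers[OF \<delta>] unfolding covers_def by blast
      have "\<psi> z \<in> topspace (total Q)" if "z \<in> topspace (total Z)" for z
        using homeomorphic_imp_surjective_map[OF Z(2)] that by blast
      then have "\<forall>z\<in>topspace (total Z). proj (delta_cover X C \<delta>) ((f \<circ> \<psi>) z) = proj Z z"
        using f(2) Z(3) by simp
      moreover have "covering_map (total Z) (total (delta_cover X C \<delta>)) (f \<circ> \<psi>)"
        by (rule covering_map_homeomorphic_source[OF f(1) Z(2)])
      ultimately show ?thesis unfolding covers_def by blast
    qed
    then have "covers Z Y" using Y Z(1) unfolding universal_delta_cover_def by blast
    then obtain a where a: "covering_map (total Z) (total Y) a"
        "\<forall>z\<in>topspace (total Z). proj Y (a z) = proj Z z"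
      unfolding covers_def by blast
    obtain \<phi> where \<phi>: "homeomorphic_map (total Q) (total Z) \<phi>"
        "\<And>x. x \<in> topspace (total Q) \<Longrightarrow> \<psi> (\<phi> x) = x"
      using homeomorphic_map_sym[OF Z(2)] by metis
    have \<phi>Z: "\<phi> ` topspace (total Q) = topspace (total Z)"
      using \<phi>(1) by (rule homeomorphic_imp_surjective_map)
    have a_surj: "a ` topspace (total Z) = topspace (total Y)"
      using a(1) by (simp add: covering_map_def)
    have cont: "continuous_map (total Q) (total Q) (b \<circ> (a \<circ> \<phi>))"
      using a(1) b(1) homeomorphic_imp_continuous_map[OF \<phi>(1)]
      by (auto simp: covering_map_def intro!: continuous_map_compose)
    have "proj Q ((b \<circ> (a \<circ> \<phi>)) x) = proj Q x" if x: "x \<in> topspace (total Q)" for x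
    proof -
      have z: "\<phi> x \<in> topspace (total Z)" using \<phi>Z x by blast
      then have y: "a (\<phi> x) \<in> topspace (total Y)" using a_surj by blast
      have "proj Q (b (a (\<phi> x))) = proj Z (\<phi> x)" using bspec[OF b(2) y] bspec[OF a(2) z] by simp
      also have "\<dots> = proj Q x" using Z(3)[OF z] \<phi>(2)[OF x] by simp
      finally show ?thesis by simp
    qed
    then have "inj_on (b \<circ> (a \<circ> \<phi>)) (topspace (total Q))"
      using quotient_cover_endomorphism_inj[OF ctx H(2), of "b \<circ> (a \<circ> \<phi>)"] cont by (simp add: Q_def)
    then have "inj_on b ((a \<circ> \<phi>) ` topspace (total Q))" by (rule inj_on_imageI)
    then have "inj_on b (topspace (total Y))"
      using \<phi>Z a_surj by (metis image_comp)
    then have "homeomorphic_map (total Y) (total Q) b"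
      using homeomorphic_map_if_injective_covering_map[OF b(1)] by simp
    then show ?thesis using b(2) unfolding same_cover_def by blast
  qed
  show ?thesis
  proof (intro conjI exI[of _ s] allI impI s)
    show "universal_delta_cover X C (delta_cover X C s)" using univ by (simp only: Q)
    show "same_cover Y (delta_cover X C s)" if "universal_delta_cover X C Y" for Y :: "('c, 'a) cover"
      using uniq[OF that] by (simp only: Q)
    show "Inf (CovSpec X C) \<in> CovSpec X C"
      by (rule Inf_CovSpec_in_CovSpec[OF ctx assms(4,5)])
  qed
qed

end
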